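(* Let $(\Sigma^+,\sigma)$ be a one-sided countable Markov shift of finite topological entropy, and let $\mathcal{E}_\sigma$ be the set of ergodic $\sigma$-invariant Borel probability measures on $\Sigma^+$, endowed with the weak$^*$ topology. Then the entropy map $\mathcal{E}_\sigma\to\mathbb{R}$, $\mu\mapsto h_\mu(\sigma)$, is upper semi-continuous; that is, if $(\mu_n)_n$ is a sequence in $\mathcal{E}_\sigma$ converging in the weak$^*$ topology to $\mu\in\mathcal{E}_\sigma$, then $$\limsup_{n\to\infty} h_{\mu_n}(\sigma)\le h_\mu(\sigma).$$
   Context: One-sided countable Markov shift: let $\mathcal{A}$ be a countable alphabet and $S=(s_{ij})_{\mathcal{A}\times\mathcal{A}}$ a matrix of zeros and ones. Set $\Sigma^+=\{x\in\mathcal{A}^{\mathbb{N}}: s_{x_ix_{i+1}}=1\text{ for every } i\in\mathbb{N}\}$ with the shift map $(\sigma(x))_i=x_{i+1}$, and the topology generated by the cylinder sets (sets of sequences with finitely many consecutive prescribed coordinates). The shift is not assumed to be transitive. $h_\mu(\sigma)$ denotes the measure-theoretic (Kolmogorov–Sinai) entropy. The topological entropy is $h_{top}(\sigma)=\sup\{h_\mu(\sigma):\mu\in\mathcal{E}_\sigma\}$. Weak$^*$ convergence $\mu_n\to\mu$ means $\int\phi\,d\mu_n\to\int\phi\,d\mu$ for every bounded continuous $\phi:\Sigma^+\to\mathbb{R}$. *)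

theory Defs
  imports "HOL-Probability.Probability"
begin

section \<open>Invariant and ergodic probability measures\<close>

definition invariant_prob_measure :: "('b \<Rightarrow> 'b) \<Rightarrow> 'b measure \<Rightarrow> bool" where
  "invariant_prob_measure T M \<longleftrightarrow> prob_space M \<and> T \<in> M \<rightarrow>\<^sub>M M \<and> distr M M T = M"

definition ergodic_prob_measure :: "('b \<Rightarrow> 'b) \<Rightarrow> 'b measure \<Rightarrow> bool" where
  "ergodic_prob_measure T M \<longleftrightarrow> invariant_prob_measure T M \<and>
     (\<forall>A\<in>sets M. T -` A \<inter> space M = A \<longrightarrow> measure M A = 0 \<or> measure M A = 1)"


section \<open>Kolmogorov--Sinai entropy\<close>

definition finite_measurable_partition :: "'b measure \<Rightarrow> 'b set set \<Rightarrow> bool" where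
  "finite_measurable_partition M P \<longleftrightarrow> finite P \<and> P \<subseteq> sets M \<and> partition_on (space M) P"

text \<open>Atoms of measure zero contribute \<open>0 * ln 0 = 0\<close>, as in the usual convention.\<close>

definition partition_entropy :: "'b measure \<Rightarrow> 'b set set \<Rightarrow> real" where
  "partition_entropy M P = - (\<Sum>A\<in>P. measure M A * ln (measure M A))"

definition preimage_partition :: "('b \<Rightarrow> 'b) \<Rightarrow> 'b measure \<Rightarrow> 'b set set \<Rightarrow> 'b set set" where
  "preimage_partition T M P = (\<lambda>A. T -` A \<inter> space M) ` P"

text \<open>The join of \<open>P, T\<^sup>-\<^sup>1 P, \<dots>, T\<^sup>-\<^sup>(\<^sup>n\<^sup>-\<^sup>1\<^sup>) P\<close>; it is the intended object only for \<open>n \<ge> 1\<close>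
  (an empty join is the singleton of \<open>UNIV\<close>). The operator \<open>common_refinement\<close> drops the empty set.\<close>

definition dynamical_join :: "('b \<Rightarrow> 'b) \<Rightarrow> 'b measure \<Rightarrow> nat \<Rightarrow> 'b set set \<Rightarrow> 'b set set" where
  "dynamical_join T M n P = common_refinement ((\<lambda>i. preimage_partition (T ^^ i) M P) ` {..<n})"

text \<open>For an invariant probability measure and a finite measurable partition the limit exists
  by subadditivity; the value for \<open>n = 0\<close> is irrelevant.\<close>

definition entropy_wrt_partition :: "('b \<Rightarrow> 'b) \<Rightarrow> 'b measure \<Rightarrow> 'b set set \<Rightarrow> real" where
  "entropy_wrt_partition T M P =
     lim (\<lambda>n. partition_entropy M (dynamical_join T M n P) / real n)"

definition ks_entropy :: "('b \<Rightarrow> 'b) \<Rightarrow> 'b measure \<Rightarrow> ereal" where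
  "ks_entropy T M =
     (SUP P\<in>{P. finite_measurable_partition M P}. ereal (entropy_wrt_partition T M P))"


section \<open>One-sided countable Markov shifts\<close>

definition markov_shift_space :: "('a \<Rightarrow> 'a \<Rightarrow> nat) \<Rightarrow> (nat \<Rightarrow> 'a) set" where
  "markov_shift_space S = {x. \<forall>i. S (x i) (x (Suc i)) = 1}"

definition shift_map :: "(nat \<Rightarrow> 'a) \<Rightarrow> (nat \<Rightarrow> 'a)" where
  "shift_map x = (\<lambda>i. x (Suc i))"

definition cylinder :: "('a \<Rightarrow> 'a \<Rightarrow> nat) \<Rightarrow> nat \<Rightarrow> 'a list \<Rightarrow> (nat \<Rightarrow> 'a) set" where
  "cylinder S k w = {x \<in> markov_shift_space S. \<forall>j<length w. x (k + j) = w ! j}"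

definition markov_shift_topology :: "('a \<Rightarrow> 'a \<Rightarrow> nat) \<Rightarrow> (nat \<Rightarrow> 'a) topology" where
  "markov_shift_topology S = topology_generated_by {cylinder S k w | k w. True}"

lemma topspace_markov_shift_topology:
  "topspace (markov_shift_topology S) = markov_shift_space S"
proof -
  have "cylinder S 0 [] = markov_shift_space S"
    by (simp add: cylinder_def)
  moreover have "cylinder S k w \<subseteq> markov_shift_space S" for k w
    by (auto simp: cylinder_def)
  ultimately show ?thesis
    unfolding markov_shift_topology_def topology_generated_by_topspace by blast
qed

definition markov_shift_borel :: "('a \<Rightarrow> 'a \<Rightarrow> nat) \<Rightarrow> (nat \<Rightarrow> 'a) measure" where
  "markov_shift_borel S = sigma (markov_shift_space S) {U. openin (markov_shift_topology S) U}"

definition ergodic_measures :: "('a \<Rightarrow> 'a \<Rightarrow> nat) \<Rightarrow> (nat \<Rightarrow> 'a) measure set" where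
  "ergodic_measures S =
     {\<mu>. sets \<mu> = sets (markov_shift_borel S) \<and> ergodic_prob_measure shift_map \<mu>}"

text \<open>If there is no ergodic measure, the supremum below is \<open>-\<infinity>\<close>.\<close>

definition topological_entropy :: "('a \<Rightarrow> 'a \<Rightarrow> nat) \<Rightarrow> ereal" where
  "topological_entropy S = (SUP \<mu>\<in>ergodic_measures S. ks_entropy shift_map \<mu>)"

definition weak_star_tendsto ::
    "('a \<Rightarrow> 'a \<Rightarrow> nat) \<Rightarrow> (nat \<Rightarrow> (nat \<Rightarrow> 'a) measure) \<Rightarrow> (nat \<Rightarrow> 'a) measure \<Rightarrow> bool" where
  "weak_star_tendsto S \<mu>s \<mu> \<longleftrightarrow>
     (\<forall>\<phi>. continuous_map (markov_shift_topology S) euclideanreal \<phi> \<and>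
          bounded (\<phi> ` markov_shift_space S) \<longrightarrow>
          (\<lambda>n. \<integral>x. \<phi> x \<partial>(\<mu>s n)) \<longlonglongrightarrow> (\<integral>x. \<phi> x \<partial>\<mu>))"

end

theory Submission
  imports Defs
begin

text \<open>
  Choose a letter \<open>a\<close> with \<open>\<mu>[a] > 0\<close>. If the entropy is bounded by \<open>h\<close>, there are at most
  \<open>exp (h l)\<close> loops of length \<open>l\<close> at \<open>a\<close>: independent concatenation of \<open>N\<close> such loops gives an ergodic
  measure of entropy at least \<open>ln N / l\<close>. In particular only a finite set \<open>F\<close> of letters occurs in
  loops of length at most \<open>2T\<close>. Knowing which letters of an orbit lie in \<open>F\<close> (and which letters they
  are) determines the orbit inside all short loops at \<open>a\<close>, while a long loop of length \<open>l\<close> leaves at most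
  \<open>exp (h l)\<close> possibilities. Hence for every ergodic \<open>\<nu>\<close> charging \<open>[a]\<close>
  \<open>h\<^sub>\<nu>(\<sigma>) \<le> h\<^sub>\<nu>(\<sigma>, F) + 2 h r\<^sub>T(\<nu>)\<close>, where \<open>r\<^sub>T(\<nu>)\<close> is the measure of the set of orbits avoiding \<open>a\<close>
  up to time \<open>T\<close>. Both \<open>r\<^sub>T\<close> and the entropies of the finitely many cylinder-type
  events approximating \<open>h\<^sub>\<nu>(\<sigma>, F)\<close> from above are weak* continuous, and
  \<open>r\<^sub>T(\<mu>) \<longlonglongrightarrow> 0\<close> by ergodicity.
\<close>

section \<open>Shannon entropy of simple functions\<close>

text \<open>The alphabet may be infinite and the space need not be compact: the partition into
  single letters can have infinite Shannon entropy, and the measures can move mass onto ever new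
  letters. Hence every entropy below is that of a finite code. A finite code alone says nothing
  about what happens among the merged letters; the exponential bound on loop counts, the same for
  all measures, pays for that. The length \<open>2 * T\<close> is chosen so that in a longer gap
  between visits to \<open>a\<close> each position has, on one side, \<open>T\<close> consecutive
  positions without a visit; the two possible sides give the factor 2 in front of \<open>h\<close>.
  Ergodicity of the approximating measures enters through recurrence: as \<mu>[a] > 0, all but
  finitely many of them charge \<open>[a]\<close>, hence return to \<open>a\<close> almost surely,
  and the stretches before the first and after the last visit cost nothing per symbol in the limit.
  Since the topological entropy is a supremum over ergodic measures, the loops must be turned into a
  measure that is ergodic and not just invariant.\<close>

definition shannon_entropy :: "'b measure \<Rightarrow> ('b \<Rightarrow> 'c) \<Rightarrow> real" where
  "shannon_entropy M X =
     - (\<Sum>v\<in>X ` space M. measure M (X -` {v} \<inter> space M) * ln (measure M (X -` {v} \<inter> space M)))"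

lemma (in prob_space) integral_simple_function_eq_sum:
  fixes g :: "'c \<Rightarrow> real"
  assumes X: "simple_function M X"
  shows "(\<integral>\<omega>. g (X \<omega>) \<partial>M) = (\<Sum>v\<in>X ` space M. prob (X -` {v} \<inter> space M) * g v)"
    and "integrable M (\<lambda>\<omega>. g (X \<omega>))"
proof -
  have fin: "finite (X ` space M)" and meas: "X -` {v} \<inter> space M \<in> events" for v
    using simple_functionD[OF X] by auto
  have eq: "g (X \<omega>) = (\<Sum>v\<in>X ` space M. indicator (X -` {v} \<inter> space M) \<omega> * g v)"
    if "\<omega> \<in> space M" for \<omega>
  proof -
    have "(\<Sum>v\<in>X ` space M. indicator (X -` {v} \<inter> space M) \<omega> * g v)
        = (\<Sum>v\<in>X ` space M. if v = X \<omega> then g v else 0)"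
      using that by (intro sum.cong) (auto simp: indicator_def)
    then show ?thesis
      using that fin by simp
  qed
  have int: "integrable M (\<lambda>\<omega>. indicator (X -` {v} \<inter> space M) \<omega> * g v)" for v
    using meas by (auto intro!: integrable_mult_left integrable_real_indicator simp: less_top[symmetric])
  have "integrable M (\<lambda>\<omega>. \<Sum>v\<in>X ` space M. indicator (X -` {v} \<inter> space M) \<omega> * g v)"
    using int by (intro Bochner_Integration.integrable_sum)
  then show "integrable M (\<lambda>\<omega>. g (X \<omega>))"
    by (rule Bochner_Integration.integrable_cong[THEN iffD1, rotated -1]) (auto simp: eq)
  have "(\<integral>\<omega>. g (X \<omega>) \<partial>M) = (\<integral>\<omega>. (\<Sum>v\<in>X ` space M. indicator (X -` {v} \<inter> space M) \<omega> * g v) \<partial>M)"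
    by (rule Bochner_Integration.integral_cong) (auto simp: eq)
  also have "\<dots> = (\<Sum>v\<in>X ` space M. \<integral>\<omega>. indicator (X -` {v} \<inter> space M) \<omega> * g v \<partial>M)"
    using int by (rule Bochner_Integration.integral_sum)
  also have "\<dots> = (\<Sum>v\<in>X ` space M. prob (X -` {v} \<inter> space M) * g v)"
    using meas by (intro sum.cong) auto
  finally show "(\<integral>\<omega>. g (X \<omega>) \<partial>M) = (\<Sum>v\<in>X ` space M. prob (X -` {v} \<inter> space M) * g v)" .
qed

lemma (in prob_space) sum_prob_simple_function:
  assumes X: "simple_function M X"
  shows "(\<Sum>v\<in>X ` space M. prob (X -` {v} \<inter> space M)) = 1"
  using integral_simple_function_eq_sum(1)[OF X, of "\<lambda>_. 1"] by (simp add: prob_space)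

lemma (in prob_space) shannon_entropy_integral:
  assumes X: "simple_function M X"
  shows "shannon_entropy M X = (\<integral>\<omega>. - ln (prob (X -` {X \<omega>} \<inter> space M)) \<partial>M)"
  using integral_simple_function_eq_sum(1)[OF X, of "\<lambda>v. - ln (prob (X -` {v} \<inter> space M))"]
  by (simp add: shannon_entropy_def sum_negf)

lemma (in prob_space) shannon_entropy_nonneg:
  assumes X: "simple_function M X"
  shows "0 \<le> shannon_entropy M X"
proof -
  have "prob A * ln (prob A) \<le> 0" for A
    by (cases "prob A = 0") (auto intro!: mult_nonneg_nonpos simp: zero_less_measure_iff)
  then show ?thesis
    unfolding shannon_entropy_def by (auto intro!: sum_nonpos)
qed

text \<open>Gibbs' inequality for a subprobability kernel \<open>q\<close>, read as a guess for the conditional law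
  of \<open>X\<close> given \<open>Y\<close>. It stands in for all of the calculus of conditional entropies.\<close>

lemma (in prob_space) shannon_entropy_gibbs:
  fixes X :: "'a \<Rightarrow> 'c" and Y :: "'a \<Rightarrow> 'd" and q :: "'c \<Rightarrow> 'd \<Rightarrow> real"
  assumes X: "simple_function M X" and Y: "simple_function M Y"
    and q: "\<And>x y. 0 \<le> q x y" "\<And>y. y \<in> Y ` space M \<Longrightarrow> (\<Sum>x\<in>X ` space M. q x y) \<le> 1"
    and pos: "\<And>x y. 0 < prob {\<omega> \<in> space M. X \<omega> = x \<and> Y \<omega> = y} \<Longrightarrow> 0 < q x y"
    and f: "\<And>\<omega>. \<omega> \<in> space M \<Longrightarrow> - ln (q (X \<omega>) (Y \<omega>)) \<le> f \<omega>" "integrable M f"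
  shows "shannon_entropy M X \<le> shannon_entropy M Y + (\<integral>\<omega>. f \<omega> \<partial>M)"
proof -
  define Z where "Z = (\<lambda>\<omega>. (X \<omega>, Y \<omega>))"
  have Z: "simple_function M Z"
    unfolding Z_def by (rule simple_function_Pair[OF X Y])
  define pX where "pX v = prob (X -` {v} \<inter> space M)" for v
  define pY where "pY v = prob (Y -` {v} \<inter> space M)" for v
  define p where "p v = prob (Z -` {v} \<inter> space M)" for v
  have mX: "X -` {v} \<inter> space M \<in> events" for v using simple_functionD[OF X] by auto
  have mY: "Y -` {v} \<inter> space M \<in> events" for v using simple_functionD[OF Y] by auto
  have p_le: "p (x, y) \<le> pX x" "p (x, y) \<le> pY y" for x y
    unfolding p_def pX_def pY_def Z_def by (auto intro!: finite_measure_mono mX mY)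
  have HX: "shannon_entropy M X = (\<integral>\<omega>. - ln (pX (fst (Z \<omega>))) \<partial>M)"
    unfolding shannon_entropy_integral[OF X] by (simp add: Z_def pX_def)
  have HY: "shannon_entropy M Y = (\<integral>\<omega>. - ln (pY (snd (Z \<omega>))) \<partial>M)"
    unfolding shannon_entropy_integral[OF Y] by (simp add: Z_def pY_def)
  have le: "(\<integral>\<omega>. - ln (q (fst (Z \<omega>)) (snd (Z \<omega>))) \<partial>M) \<le> (\<integral>\<omega>. f \<omega> \<partial>M)"
  proof (rule integral_mono)
    show "integrable M (\<lambda>\<omega>. - ln (q (fst (Z \<omega>)) (snd (Z \<omega>))))"
      by (rule integral_simple_function_eq_sum(2)[OF Z])
  qed (use f in \<open>simp_all add: Z_def\<close>)
  \<comment> \<open>With \<open>p\<close> the joint probability, \<open>pX\<close> is replaced by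
    the smaller \<open>p\<close>, and \<open>ln t \<le> t - 1\<close> is applied to
    \<open>t = pY * q / p\<close>. The right-hand sides add up to at most 1 - 1 = 0, because
    \<open>q\<close> has mass at most 1 for each \<open>y\<close>. Pairs of mass zero are treated
    apart, since \<open>pos\<close> says nothing about \<open>q\<close> there.\<close>
  have bound: "p z * (- ln (pX (fst z)) + ln (pY (snd z)) + ln (q (fst z) (snd z)))
      \<le> pY (snd z) * q (fst z) (snd z) - p z" if "z \<in> Z ` space M" for z
  proof (cases "p z = 0")
    case True
    then show ?thesis by (simp add: pY_def q)
  next
    case False
    obtain x y where z: "z = (x, y)" by fastforce
    have p: "0 < p z" using False by (simp add: p_def zero_less_measure_iff)
    have px: "0 < pX x" "0 < pY y" using p p_le[of x y] by (auto simp: z)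
    have "Z -` {z} \<inter> space M = {\<omega> \<in> space M. X \<omega> = x \<and> Y \<omega> = y}"
      by (auto simp: Z_def z)
    then have qp: "0 < q x y" using p pos[of x y] by (simp add: p_def)
    have "- ln (pX x) \<le> - ln (p z)" using p_le(1)[of x y] p px by (simp add: z)
    then have "- ln (pX x) + ln (pY y) + ln (q x y) \<le> ln (pY y * q x y / p z)"
      using p px qp by (simp add: ln_mult ln_div)
    also have "\<dots> \<le> pY y * q x y / p z - 1"
      using p px qp by (intro ln_le_minus_one) simp
    finally have "p z * (- ln (pX x) + ln (pY y) + ln (q x y)) \<le> p z * (pY y * q x y / p z - 1)"
      using p by (intro mult_left_mono) auto
    also have "\<dots> = pY y * q x y - p z" using p by (simp add: field_simps)
    finally show ?thesis by (simp add: z)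
  qed
  have finX: "finite (X ` space M)" and finY: "finite (Y ` space M)"
    using simple_functionD X Y by auto
  have i: "integrable M (\<lambda>\<omega>. g (Z \<omega>))" for g :: "_ \<Rightarrow> real"
    by (rule integral_simple_function_eq_sum(2)[OF Z])
  have "(\<integral>\<omega>. - ln (pX (fst (Z \<omega>))) \<partial>M) - (\<integral>\<omega>. - ln (pY (snd (Z \<omega>))) \<partial>M)
      - (\<integral>\<omega>. - ln (q (fst (Z \<omega>)) (snd (Z \<omega>))) \<partial>M)
      = (\<integral>\<omega>. - ln (pX (fst (Z \<omega>))) + ln (pY (snd (Z \<omega>))) + ln (q (fst (Z \<omega>)) (snd (Z \<omega>))) \<partial>M)"
    using i[of "\<lambda>z. ln (pX (fst z))"] i[of "\<lambda>z. ln (pY (snd z))"] i[of "\<lambda>z. ln (q (fst z) (snd z))"]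
    by simp
  also have "\<dots> = (\<Sum>z\<in>Z ` space M. p z * (- ln (pX (fst z)) + ln (pY (snd z)) + ln (q (fst z) (snd z))))"
    unfolding p_def
    by (rule integral_simple_function_eq_sum(1)[OF Z,
        of "\<lambda>z. - ln (pX (fst z)) + ln (pY (snd z)) + ln (q (fst z) (snd z))"])
  also have "\<dots> \<le> (\<Sum>z\<in>Z ` space M. pY (snd z) * q (fst z) (snd z) - p z)"
    by (intro sum_mono bound)
  also have "\<dots> = (\<Sum>z\<in>Z ` space M. pY (snd z) * q (fst z) (snd z)) - 1"
    using sum_prob_simple_function[OF Z] by (simp add: sum_subtractf p_def)
  also have "(\<Sum>z\<in>Z ` space M. pY (snd z) * q (fst z) (snd z))
      \<le> (\<Sum>z\<in>X ` space M \<times> Y ` space M. pY (snd z) * q (fst z) (snd z))"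
    by (rule sum_mono2) (use finX finY q in \<open>auto simp: Z_def pY_def\<close>)
  also have "\<dots> = (\<Sum>y\<in>Y ` space M. pY y * (\<Sum>x\<in>X ` space M. q x y))"
    unfolding sum_distrib_left by (subst sum.swap) (simp add: sum.cartesian_product case_prod_beta)
  also have "\<dots> \<le> (\<Sum>y\<in>Y ` space M. pY y * 1)"
    by (intro sum_mono mult_left_mono q) (auto simp: pY_def)
  also have "\<dots> = 1"
    using sum_prob_simple_function[OF Y] by (simp add: pY_def)
  finally show ?thesis
    using le unfolding HX HY by simp
qed

text \<open>The kernel is the point mass at \<open>g y\<close>: a guess that never fails costs
  \<open>- ln 1 = 0\<close>.\<close>

lemma (in prob_space) shannon_entropy_mono:
  assumes Y: "simple_function M Y" and X: "\<And>\<omega>. \<omega> \<in> space M \<Longrightarrow> X \<omega> = g (Y \<omega>)"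
  shows "shannon_entropy M X \<le> shannon_entropy M Y"
proof -
  have "simple_function M (\<lambda>\<omega>. g (Y \<omega>))" using Y by (rule simple_function_compose1)
  then have sX: "simple_function M X"
    by (rule simple_function_cong[THEN iffD1, rotated]) (simp add: X)
  have "shannon_entropy M X \<le> shannon_entropy M Y + (\<integral>\<omega>. 0 \<partial>M)"
  proof (rule shannon_entropy_gibbs[OF sX Y])
    show "(\<Sum>x\<in>X ` space M. if x = g y then 1 else 0) \<le> (1::real)" for y
      using simple_functionD(1)[OF sX] by (simp add: sum.delta)
  next
    fix x y assume "0 < prob {\<omega> \<in> space M. X \<omega> = x \<and> Y \<omega> = y}"
    then have "{\<omega> \<in> space M. X \<omega> = x \<and> Y \<omega> = y} \<noteq> {}"
      by (metis less_irrefl measure_empty)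
    then show "0 < (if x = g y then 1 else (0::real))" using X by auto
  qed (simp_all add: X)
  then show ?thesis by simp
qed

text \<open>The pair is guessed from \<open>X\<close> by copying the first component and drawing the
  second from the law of \<open>Y\<close>; the expected cost is then exactly the entropy of
  \<open>Y\<close>.\<close>

lemma (in prob_space) shannon_entropy_subadditive:
  assumes X: "simple_function M X" and Y: "simple_function M Y"
  shows "shannon_entropy M (\<lambda>\<omega>. (X \<omega>, Y \<omega>)) \<le> shannon_entropy M X + shannon_entropy M Y"
proof -
  define p where "p v = prob (Y -` {v} \<inter> space M)" for v
  have Z: "simple_function M (\<lambda>\<omega>. (X \<omega>, Y \<omega>))"
    by (rule simple_function_Pair[OF X Y])
  have "shannon_entropy M (\<lambda>\<omega>. (X \<omega>, Y \<omega>)) \<le> shannon_entropy M X + (\<integral>\<omega>. - ln (p (Y \<omega>)) \<partial>M)"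
  proof (rule shannon_entropy_gibbs[OF Z X])
    fix x' assume "x' \<in> X ` space M"
    have "(\<Sum>z\<in>(\<lambda>\<omega>. (X \<omega>, Y \<omega>)) ` space M. if fst z = x' then p (snd z) else 0)
        \<le> (\<Sum>z\<in>X ` space M \<times> Y ` space M. if fst z = x' then p (snd z) else 0)"
      by (rule sum_mono2) (use simple_functionD[OF X] simple_functionD[OF Y] in \<open>auto simp: p_def\<close>)
    also have "\<dots> = (\<Sum>x\<in>X ` space M. if x = x' then (\<Sum>y\<in>Y ` space M. p y) else 0)"
      by (subst sum.cartesian_product') (auto intro!: sum.cong)
    also have "\<dots> \<le> 1"
      using simple_functionD(1)[OF X] sum_prob_simple_function[OF Y] by (simp add: p_def)
    finally show "(\<Sum>z\<in>(\<lambda>\<omega>. (X \<omega>, Y \<omega>)) ` space M. if fst z = x' then p (snd z) else 0) \<le> 1" .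
  next
    fix z x' assume *: "0 < prob {\<omega> \<in> space M. (X \<omega>, Y \<omega>) = z \<and> X \<omega> = x'}"
    then have "{\<omega> \<in> space M. (X \<omega>, Y \<omega>) = z \<and> X \<omega> = x'} \<noteq> {}"
      by (metis less_irrefl measure_empty)
    then have "fst z = x'" by auto
    moreover have "prob {\<omega> \<in> space M. (X \<omega>, Y \<omega>) = z \<and> X \<omega> = x'} \<le> p (snd z)"
      unfolding p_def using simple_functionD(2)[OF Y] by (intro finite_measure_mono) auto
    ultimately show "0 < (if fst z = x' then p (snd z) else 0)"
      using * by simp
  qed (use integral_simple_function_eq_sum(2)[OF Y, of "\<lambda>y. - ln (p y)"] in \<open>simp_all add: p_def\<close>)
  then show ?thesis
    by (simp add: shannon_entropy_integral[OF Y] p_def)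
qed

section \<open>Entropy rates\<close>

definition fibres :: "'b measure \<Rightarrow> ('b \<Rightarrow> 'c) \<Rightarrow> 'b set set" where
  "fibres M X = (\<lambda>v. X -` {v} \<inter> space M) ` X ` space M"

definition itinerary :: "('b \<Rightarrow> 'b) \<Rightarrow> ('b \<Rightarrow> 'c) \<Rightarrow> nat \<Rightarrow> 'b \<Rightarrow> 'c list" where
  "itinerary T X n \<omega> = map (\<lambda>i. X ((T ^^ i) \<omega>)) [0..<n]"

definition entropy_rate :: "('b \<Rightarrow> 'b) \<Rightarrow> 'b measure \<Rightarrow> ('b \<Rightarrow> 'c) \<Rightarrow> real" where
  "entropy_rate T M X = entropy_wrt_partition T M (fibres M X)"

lemma partition_entropy_fibres: "partition_entropy M (fibres M X) = shannon_entropy M X"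
proof -
  have "inj_on (\<lambda>v. X -` {v} \<inter> space M) (X ` space M)"
    by (auto simp: inj_on_def)
  then show ?thesis
    by (simp add: partition_entropy_def shannon_entropy_def fibres_def sum.reindex del: image_image)
qed

lemma finite_measurable_partition_fibres:
  assumes "simple_function M X"
  shows "finite_measurable_partition M (fibres M X)"
  using simple_functionD[OF assms]
  by (auto simp: finite_measurable_partition_def fibres_def partition_on_def disjoint_def)

text \<open>Each point is labelled by its own atom, so the labels have type \<open>'b set\<close>
  whatever the partition. This is why the Kolmogorov-Sinai entropy can later be bounded by testing
  set-valued functions only.\<close>

lemma finite_measurable_partitionE:
  assumes "finite_measurable_partition M P"
  obtains X :: "'b \<Rightarrow> 'b set" where "simple_function M X" "P = fibres M X"
proof -
  have fin: "finite P" and sets: "P \<subseteq> sets M" and part: "partition_on (space M) P"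
    using assms by (auto simp: finite_measurable_partition_def)
  define X where "X \<omega> = (THE A. A \<in> P \<and> \<omega> \<in> A)" for \<omega>
  have X: "X \<omega> = A" if "A \<in> P" "\<omega> \<in> A" for A \<omega>
    unfolding X_def using that part by (intro the_equality) (auto simp: partition_on_def disjoint_def)
  have sp: "\<exists>A\<in>P. \<omega> \<in> A" if "\<omega> \<in> space M" for \<omega>
    using that part by (auto simp: partition_on_def)
  have sub: "A \<subseteq> space M" "A \<noteq> {}" if "A \<in> P" for A
    using that part by (auto simp: partition_on_def)
  have img: "X ` space M = P"
  proof
    show "X ` space M \<subseteq> P" using sp X by force
    show "P \<subseteq> X ` space M"
    proof
      fix A assume A: "A \<in> P"
      then obtain \<omega> where "\<omega> \<in> A" using sub by blast
      with A show "A \<in> X ` space M" using X sub by (metis image_eqI subsetD)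
    qed
  qed
  have vim: "X -` {A} \<inter> space M = A" if "A \<in> P" for A
  proof (intro equalityI subsetI)
    fix \<omega> assume "\<omega> \<in> X -` {A} \<inter> space M"
    then show "\<omega> \<in> A" using X sp by force
  next
    fix \<omega> assume "\<omega> \<in> A"
    then show "\<omega> \<in> X -` {A} \<inter> space M" using that X sub by blast
  qed
  have "simple_function M X"
    unfolding simple_function_def img using vim sets fin by (simp add: subset_iff)
  moreover have "P = fibres M X"
    unfolding fibres_def img using vim by simp
  ultimately show thesis using that by blast
qed

lemma funpow_Pi: "T \<in> A \<rightarrow> A \<Longrightarrow> T ^^ i \<in> A \<rightarrow> A"
  by (induction i) auto

text \<open>A block of the join that contains \<omega> can only be the intersection of the atoms of
  \<omega>, because at each time the selected block must contain \<omega>. The case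
  \<open>n = 0\<close> is excluded since the empty join consists of \<open>UNIV\<close> and not of
  \<open>space M\<close>.\<close>

lemma dynamical_join_fibres:
  assumes T: "T \<in> space M \<rightarrow> space M" and n: "n \<noteq> 0"
  shows "dynamical_join T M n (fibres M X) = fibres M (itinerary T X n)"
proof -
  define atom where "atom i \<omega> = {\<omega>' \<in> space M. X ((T ^^ i) \<omega>') = X ((T ^^ i) \<omega>)}" for i \<omega>
  define P where "P i = preimage_partition (T ^^ i) M (fibres M X)" for i
  have Ti: "(T ^^ i) \<omega> \<in> space M" if "\<omega> \<in> space M" for i \<omega>
    using funpow_Pi[OF T, of i] that by auto
  have P_atom: "A = atom i \<omega>" if "A \<in> P i" "\<omega> \<in> A" for A i \<omega>
    using that Ti by (auto simp: P_def preimage_partition_def fibres_def atom_def)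
  have atom_P: "atom i \<omega> \<in> P i" if "\<omega> \<in> space M" for i \<omega>
    unfolding P_def preimage_partition_def fibres_def atom_def image_image
    by (rule image_eqI[of _ _ "(T ^^ i) \<omega>"]) (use that Ti in auto)
  have mem: "\<omega> \<in> atom i \<omega>" if "\<omega> \<in> space M" for i \<omega>
    using that by (auto simp: atom_def)
  have fib: "fibres M (itinerary T X n) = (\<lambda>\<omega>. \<Inter>i<n. atom i \<omega>) ` space M"
    unfolding fibres_def image_image
  proof (rule image_cong[OF refl])
    fix \<omega> assume "\<omega> \<in> space M"
    then show "itinerary T X n -` {itinerary T X n \<omega>} \<inter> space M = (\<Inter>i<n. atom i \<omega>)"
      using n by (auto simp: itinerary_def atom_def)
  qed
  have "dynamical_join T M n (fibres M X) = (\<Union>f\<in>(\<Pi> Q\<in>P ` {..<n}. Q). {\<Inter> (f ` P ` {..<n})}) - {{}}"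
    unfolding dynamical_join_def common_refinement P_def ..
  also have "\<dots> = fibres M (itinerary T X n)"
    unfolding fib
  proof (intro equalityI subsetI)
    fix A assume "A \<in> (\<Union>f\<in>(\<Pi> Q\<in>P ` {..<n}. Q). {\<Inter> (f ` P ` {..<n})}) - {{}}"
    then obtain f \<omega> where f: "f \<in> (\<Pi> Q\<in>P ` {..<n}. Q)" and A: "A = \<Inter> (f ` P ` {..<n})" and \<omega>: "\<omega> \<in> A"
      by auto
    have eq: "f (P i) = atom i \<omega>" if "i < n" for i
      using that f \<omega> A by (intro P_atom) auto
    then have "A = (\<Inter>i<n. atom i \<omega>)" using A by auto
    moreover have "\<omega> \<in> space M" using eq[of 0] \<omega> A n by (auto simp: atom_def)
    ultimately show "A \<in> (\<lambda>\<omega>. \<Inter>i<n. atom i \<omega>) ` space M" by auto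
  next
    fix A assume "A \<in> (\<lambda>\<omega>. \<Inter>i<n. atom i \<omega>) ` space M"
    then obtain \<omega> where \<omega>: "\<omega> \<in> space M" and A: "A = (\<Inter>i<n. atom i \<omega>)" by auto
    \<comment> \<open>The selection is a function of the partition and not of the time, as
      \<open>common_refinement\<close> requires. Times with equal partitions therefore get the same
      block, which is consistent because \<omega> singles the block out.\<close>
    define f where "f Q = (THE B. B \<in> Q \<and> \<omega> \<in> B)" for Q
    have f: "f (P i) = atom i \<omega>" for i
      unfolding f_def using \<omega> atom_P mem P_atom by (intro the_equality) auto
    have "f \<in> (\<Pi> Q\<in>P ` {..<n}. Q)" using f atom_P[OF \<omega>] by auto
    moreover have "A = \<Inter> (f ` P ` {..<n})" using A f by auto
    moreover have "\<omega> \<in> A" using A mem \<omega> by auto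
    ultimately show "A \<in> (\<Union>f\<in>(\<Pi> Q\<in>P ` {..<n}. Q). {\<Inter> (f ` P ` {..<n})}) - {{}}"
      by blast
  qed
  finally show ?thesis .
qed

lemma itinerary_add: "itinerary T X (m + n) \<omega> = itinerary T X m \<omega> @ itinerary T X n ((T ^^ m) \<omega>)"
proof -
  have "[0..<m + n] = [0..<m] @ map (\<lambda>i. i + m) [0..<n]"
    by (metis add.commute map_add_upt upt_add_eq_append zero_le)
  then show ?thesis
    by (simp add: itinerary_def funpow_add comp_def)
qed

lemma simple_function_comp_measurable:
  assumes X: "simple_function M X" and T: "T \<in> M \<rightarrow>\<^sub>M M"
  shows "simple_function M (\<lambda>\<omega>. X (T \<omega>))"
  unfolding simple_function_def
proof (intro conjI ballI)
  show "finite ((\<lambda>\<omega>. X (T \<omega>)) ` space M)"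
    by (rule finite_subset[OF _ simple_functionD(1)[OF X]]) (use measurable_space[OF T] in auto)
next
  fix v
  have "(\<lambda>\<omega>. X (T \<omega>)) -` {v} \<inter> space M = T -` (X -` {v} \<inter> space M) \<inter> space M"
    using measurable_space[OF T] by auto
  then show "(\<lambda>\<omega>. X (T \<omega>)) -` {v} \<inter> space M \<in> sets M"
    using measurable_sets[OF T simple_functionD(2)[OF X]] by simp
qed

lemma simple_function_itinerary:
  assumes X: "simple_function M X" and T: "T \<in> M \<rightarrow>\<^sub>M M"
  shows "simple_function M (itinerary T X n)"
proof (induction n)
  case 0
  then show ?case by (simp add: itinerary_def[abs_def])
next
  case (Suc n)
  have Tn: "T ^^ n \<in> M \<rightarrow>\<^sub>M M" using T by (rule measurable_compose_n)
  have "simple_function M (\<lambda>\<omega>. (\<lambda>(u, v). u @ [v]) (itinerary T X n \<omega>, X ((T ^^ n) \<omega>)))"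
    by (intro simple_function_compose1[where g="\<lambda>(u, v). u @ [v]"] simple_function_Pair Suc
        simple_function_comp_measurable[OF X Tn])
  then show ?case by (simp add: itinerary_def[abs_def])
qed

section \<open>Entropy rates under an invariant measure\<close>

lemma invariant_prob_measure_funpow:
  assumes "invariant_prob_measure T M"
  shows "T ^^ n \<in> M \<rightarrow>\<^sub>M M" "distr M M (T ^^ n) = M"
proof -
  have T: "T \<in> M \<rightarrow>\<^sub>M M" and d: "distr M M T = M"
    using assms by (auto simp: invariant_prob_measure_def)
  show Tn: "T ^^ n \<in> M \<rightarrow>\<^sub>M M" for n using T by (rule measurable_compose_n)
  show "distr M M (T ^^ n) = M"
  proof (induction n)
    case (Suc n)
    have "distr M M (T ^^ Suc n) = distr (distr M M (T ^^ n)) M T"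
      using distr_distr[OF T Tn] by simp
    then show ?case using Suc d by (simp add: comp_def)
  qed (simp add: distr_id[unfolded id_def] id_def)
qed

lemma measure_invariant:
  assumes inv: "invariant_prob_measure T M" and A: "A \<in> sets M"
  shows "measure M ((T ^^ n) -` A \<inter> space M) = measure M A"
  using measure_distr[OF invariant_prob_measure_funpow(1)[OF inv] A, of n]
  by (simp add: invariant_prob_measure_funpow(2)[OF inv])

lemma shannon_entropy_invariant:
  assumes inv: "invariant_prob_measure T M" and X: "simple_function M X"
  shows "shannon_entropy M (\<lambda>\<omega>. X ((T ^^ n) \<omega>)) = shannon_entropy M X"
proof -
  interpret prob_space M using inv by (simp add: invariant_prob_measure_def)
  note T = invariant_prob_measure_funpow[OF inv, of n]
  have vim: "(\<lambda>\<omega>. X ((T ^^ n) \<omega>)) -` {v} \<inter> space M = (T ^^ n) -` (X -` {v} \<inter> space M) \<inter> space M" for v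
    using measurable_space[OF T(1)] by auto
  have p: "prob ((\<lambda>\<omega>. X ((T ^^ n) \<omega>)) -` {v} \<inter> space M) = prob (X -` {v} \<inter> space M)" for v
    unfolding vim by (intro measure_invariant inv simple_functionD X)
  have "shannon_entropy M X = (\<integral>\<omega>. - ln (prob (X -` {X \<omega>} \<inter> space M)) \<partial>distr M M (T ^^ n))"
    by (simp add: T shannon_entropy_integral[OF X])
  also have "\<dots> = (\<integral>\<omega>. - ln (prob (X -` {X ((T ^^ n) \<omega>)} \<inter> space M)) \<partial>M)"
    by (rule integral_distr[OF T(1)])
      (rule borel_measurable_integrable, rule integral_simple_function_eq_sum(2)[OF X])
  also have "\<dots> = shannon_entropy M (\<lambda>\<omega>. X ((T ^^ n) \<omega>))"
    by (simp add: shannon_entropy_integral[OF simple_function_comp_measurable[OF X T(1)]] p)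
  finally show ?thesis ..
qed

text \<open>The limit is the infimum of \<open>a k / k\<close>. The resulting bound by every single
  \<open>k\<close> is what makes upper semi-continuity possible: an infimum of continuous functions
  is upper semi-continuous.\<close>

lemma fekete_subadditive:
  fixes a :: "nat \<Rightarrow> real"
  assumes sub: "\<And>m n. a (m + n) \<le> a m + a n" and nonneg: "\<And>n. 0 \<le> a n"
  obtains L where "(\<lambda>n. a n / n) \<longlonglongrightarrow> L" "\<And>k. 0 < k \<Longrightarrow> L \<le> a k / k"
proof -
  define L where "L = (INF k\<in>{0<..}. a k / real k)"
  have bdd: "bdd_below ((\<lambda>k. a k / real k) ` {0<..})"
    by (rule bdd_belowI[of _ 0]) (auto simp: nonneg)
  have L_le: "L \<le> a k / k" if "0 < k" for k
    unfolding L_def using bdd that by (intro cINF_lower) auto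
  \<comment> \<open>Division with remainder \<open>n = q * k + r\<close>; the remainder term stays
    below the constant \<open>C\<close> chosen later and disappears after division by
    \<open>n\<close>.\<close>
  have mult: "a (q * k + r) \<le> q * a k + a r" for q k r
  proof (induction q)
    case (Suc q)
    have "a (Suc q * k + r) \<le> a k + a (q * k + r)"
      using sub[of k "q * k + r"] by (simp add: add.assoc)
    with Suc show ?case by (simp add: algebra_simps)
  qed simp
  have "(\<lambda>n. a n / n) \<longlonglongrightarrow> L"
  proof (rule LIMSEQ_I)
    fix \<epsilon> :: real assume \<epsilon>: "0 < \<epsilon>"
    have "\<exists>y\<in>(\<lambda>k. a k / real k) ` {0<..}. y < L + \<epsilon> / 2"
      using \<epsilon> bdd unfolding L_def by (intro cInf_lessD) auto
    then obtain k where k: "0 < k" "a k / k < L + \<epsilon> / 2" by auto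
    define C where "C = (\<Sum>r<k. a r)"
    have C: "a r \<le> C" if "r < k" for r
      unfolding C_def using that by (intro member_le_sum) (auto simp: nonneg)
    obtain N where N: "C / (\<epsilon> / 2) < real N" using reals_Archimedean2 by blast
    show "\<exists>no. \<forall>n\<ge>no. norm (a n / real n - L) < \<epsilon>"
    proof (intro exI allI impI)
      fix n assume n: "Suc N \<le> n"
      have "a n \<le> (n div k) * a k + a (n mod k)"
        using mult[of "n div k" k "n mod k"] by simp
      also have "\<dots> \<le> (n / k) * a k + C"
        using k C[of "n mod k"] nonneg of_nat_div_le_of_nat[of n k]
        by (intro add_mono mult_right_mono) auto
      finally have "a n / n \<le> ((n / k) * a k + C) / n"
        by (intro divide_right_mono) auto
      also have "\<dots> = a k / k + C / n" using n by (simp add: field_simps)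
      also have "C / n < \<epsilon> / 2"
        using N n \<epsilon> by (simp add: field_simps) (smt (verit) of_nat_Suc of_nat_le_iff mult_left_mono)
      finally have "a n / n < L + \<epsilon>" using k by simp
      moreover have "L \<le> a n / n" using L_le n by simp
      ultimately show "norm (a n / real n - L) < \<epsilon>" by simp
    qed
  qed
  then show thesis using that L_le by blast
qed

text \<open>\<open>lim\<close> has an unspecified value where no limit exists, so convergence must
  be known before the definition can be used. It comes from subadditivity: a word of length
  \<open>m + n\<close> is split at \<open>m\<close>, and the second half has the law of a word of
  length \<open>n\<close> by invariance.\<close>

lemma entropy_rate:
  assumes inv: "invariant_prob_measure T M" and X: "simple_function M X"
  shows "(\<lambda>n. shannon_entropy M (itinerary T X n) / n) \<longlonglongrightarrow> entropy_rate T M X"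
    and "0 < k \<Longrightarrow> entropy_rate T M X \<le> shannon_entropy M (itinerary T X k) / k"
proof -
  interpret prob_space M using inv by (simp add: invariant_prob_measure_def)
  have T: "T \<in> M \<rightarrow>\<^sub>M M" using inv by (simp add: invariant_prob_measure_def)
  have I: "simple_function M (itinerary T X n)" for n
    by (rule simple_function_itinerary[OF X T])
  have sub: "shannon_entropy M (itinerary T X (m + n))
      \<le> shannon_entropy M (itinerary T X m) + shannon_entropy M (itinerary T X n)" for m n
  proof -
    have I': "simple_function M (\<lambda>\<omega>. itinerary T X n ((T ^^ m) \<omega>))"
      by (intro simple_function_comp_measurable[OF I] invariant_prob_measure_funpow[OF inv])
    have "shannon_entropy M (itinerary T X (m + n))
        \<le> shannon_entropy M (\<lambda>\<omega>. (itinerary T X m \<omega>, itinerary T X n ((T ^^ m) \<omega>)))"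
      by (rule shannon_entropy_mono[OF simple_function_Pair[OF I I'], of _ "\<lambda>(u, v). u @ v"])
        (simp add: itinerary_add)
    also have "\<dots> \<le> shannon_entropy M (itinerary T X m) + shannon_entropy M (itinerary T X n)"
      using shannon_entropy_subadditive[OF I I'] shannon_entropy_invariant[OF inv I] by simp
    finally show ?thesis .
  qed
  obtain L where L: "(\<lambda>n. shannon_entropy M (itinerary T X n) / n) \<longlonglongrightarrow> L"
    and le: "\<And>k. 0 < k \<Longrightarrow> L \<le> shannon_entropy M (itinerary T X k) / k"
    using fekete_subadditive[of "\<lambda>n. shannon_entropy M (itinerary T X n)"] sub shannon_entropy_nonneg[OF I]
    by blast
  have "(\<lambda>n. partition_entropy M (dynamical_join T M n (fibres M X)) / real n) \<longlonglongrightarrow> L"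
  proof (rule Lim_transform_eventually[OF L])
    show "\<forall>\<^sub>F n in sequentially. shannon_entropy M (itinerary T X n) / real n
        = partition_entropy M (dynamical_join T M n (fibres M X)) / real n"
      using eventually_gt_at_top[of 0]
    proof eventually_elim
      case (elim n)
      then have "dynamical_join T M n (fibres M X) = fibres M (itinerary T X n)"
        by (intro dynamical_join_fibres) (use measurable_space[OF T] in auto)
      then show ?case by (simp add: partition_entropy_fibres)
    qed
  qed
  then have eq: "entropy_rate T M X = L"
    unfolding entropy_rate_def entropy_wrt_partition_def by (rule limI)
  show "(\<lambda>n. shannon_entropy M (itinerary T X n) / n) \<longlonglongrightarrow> entropy_rate T M X"
    using L eq by simp
  show "0 < k \<Longrightarrow> entropy_rate T M X \<le> shannon_entropy M (itinerary T X k) / k"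
    using le eq by simp
qed

lemma ks_entropy_le:
  assumes "\<And>X :: 'b \<Rightarrow> 'b set. simple_function M X \<Longrightarrow> ereal (entropy_rate T M X) \<le> B"
  shows "ks_entropy T M \<le> B"
  unfolding ks_entropy_def
proof (rule SUP_least)
  fix P assume "P \<in> {P. finite_measurable_partition M P}"
  then show "ereal (entropy_wrt_partition T M P) \<le> B"
    using assms unfolding entropy_rate_def by (auto elim: finite_measurable_partitionE)
qed

lemma entropy_rate_le_ks_entropy:
  assumes "simple_function M X"
  shows "ereal (entropy_rate T M X) \<le> ks_entropy T M"
  unfolding ks_entropy_def entropy_rate_def
  using finite_measurable_partition_fibres[OF assms] by (intro SUP_upper) auto

text \<open>\<open>c\<close> is a price per symbol and \<open>s\<close> a sublinear error; after
  division by \<open>n\<close> neither \<open>s\<close> nor the \<open>N\<close> symbols of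
  look-ahead survive. It serves a guess that reads a window of \<open>N\<close> symbols, and a
  counting argument whose boundary terms make up \<open>s\<close>.\<close>

lemma entropy_rate_le_entropy_rate:
  assumes inv: "invariant_prob_measure T M" and X: "simple_function M X" and Y: "simple_function M Y"
    and le: "\<And>n. shannon_entropy M (itinerary T X n) \<le> shannon_entropy M (itinerary T Y (n + N)) + (c * n + s n)"
    and s: "(\<lambda>n. s n / n) \<longlonglongrightarrow> 0"
  shows "entropy_rate T M X \<le> entropy_rate T M Y + c"
proof -
  have "(\<lambda>n. shannon_entropy M (itinerary T Y (n + N)) / real (n + N) * (real (n + N) / n) + c * (real n / n) + s n / n)
      \<longlonglongrightarrow> entropy_rate T M Y * 1 + c * 1 + 0"
  proof (intro tendsto_add tendsto_mult tendsto_const s)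
    show "(\<lambda>n. shannon_entropy M (itinerary T Y (n + N)) / real (n + N)) \<longlonglongrightarrow> entropy_rate T M Y"
      using entropy_rate(1)[OF inv Y] by (rule LIMSEQ_ignore_initial_segment)
    have "(\<lambda>n. 1 + real N / n) \<longlonglongrightarrow> 1 + 0"
      by (intro tendsto_add tendsto_const lim_const_over_n)
    then have "(\<lambda>n. 1 + real N / n) \<longlonglongrightarrow> 1" by simp
    then show "(\<lambda>n. real (n + N) / n) \<longlonglongrightarrow> 1"
      by (rule Lim_transform_eventually)
        (use eventually_gt_at_top[of 0] in eventually_elim, simp add: add_divide_distrib)
    show "(\<lambda>n. real n / n) \<longlonglongrightarrow> 1"
      by (rule tendsto_eventually)
        (use eventually_gt_at_top[of 0] in eventually_elim, simp)
  qed
  then have lim: "(\<lambda>n. shannon_entropy M (itinerary T Y (n + N)) / real (n + N) * (real (n + N) / n) + c * (real n / n) + s n / n)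
      \<longlonglongrightarrow> entropy_rate T M Y + c" by simp
  show ?thesis
  proof (rule LIMSEQ_le[OF entropy_rate(1)[OF inv X] lim])
    show "\<exists>N'. \<forall>n\<ge>N'. shannon_entropy M (itinerary T X n) / n
        \<le> shannon_entropy M (itinerary T Y (n + N)) / real (n + N) * (real (n + N) / n) + c * (real n / n) + s n / n"
    proof (intro exI allI impI)
      fix n :: nat assume "1 \<le> n"
      then have "shannon_entropy M (itinerary T Y (n + N)) / real (n + N) * (real (n + N) / n) + c * (real n / n) + s n / n
          = (shannon_entropy M (itinerary T Y (n + N)) + (c * n + s n)) / n"
        by (simp add: add_divide_distrib del: of_nat_add)
      then show "shannon_entropy M (itinerary T X n) / n
        \<le> shannon_entropy M (itinerary T Y (n + N)) / real (n + N) * (real (n + N) / n) + c * (real n / n) + s n / n"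
        using le[of n] by (simp add: divide_right_mono)
    qed
  qed
qed

section \<open>Guessing one process from another\<close>

text \<open>Subprobability weights chosen separately at each position multiply to a weight on words
  of mass at most 1, hence to a legitimate kernel in the Gibbs inequality for itineraries. The guess
  varies with the position, so \<open>f\<close> depends on \<open>i\<close>.\<close>

lemma sum_prod_lists_le_one:
  fixes f :: "nat \<Rightarrow> 'c \<Rightarrow> real"
  assumes V: "finite V" and f: "\<And>i v. 0 \<le> f i v" "\<And>i. (\<Sum>v\<in>V. f i v) \<le> 1"
  shows "(\<Sum>u\<in>{u. set u \<subseteq> V \<and> length u = n}. \<Prod>i<n. f i (u ! i)) \<le> 1"
  using f
proof (induction n arbitrary: f)
  case 0
  have "{u. set u \<subseteq> V \<and> length u = 0} = {[]}" by auto
  then show ?case by simp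
next
  case (Suc n)
  let ?L = "\<lambda>n. {u. set u \<subseteq> V \<and> length u = n}"
  have L: "?L (Suc n) = (\<lambda>(v, u). v # u) ` (V \<times> ?L n)"
    by (auto simp: length_Suc_conv image_iff)
  have inj: "inj_on (\<lambda>(v, u). v # u) (V \<times> ?L n)" by (auto simp: inj_on_def)
  have "(\<Sum>u\<in>?L (Suc n). \<Prod>i<Suc n. f i (u ! i)) = (\<Sum>v\<in>V. \<Sum>u\<in>?L n. f 0 v * (\<Prod>i<n. f (Suc i) (u ! i)))"
    unfolding L sum.reindex[OF inj] sum.cartesian_product
    by (intro sum.cong) (auto simp: prod.lessThan_Suc_shift simp del: prod.lessThan_Suc)
  also have "\<dots> = (\<Sum>v\<in>V. f 0 v * (\<Sum>u\<in>?L n. \<Prod>i<n. f (Suc i) (u ! i)))"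
    by (simp add: sum_distrib_left)
  also have "\<dots> \<le> (\<Sum>v\<in>V. f 0 v * 1)"
    by (intro sum_mono mult_left_mono Suc.IH Suc.prems)
  also have "\<dots> \<le> 1" using Suc.prems(2)[of 0] by simp
  finally show ?case .
qed

lemma nth_itinerary: "i < n \<Longrightarrow> itinerary T X n \<omega> ! i = X ((T ^^ i) \<omega>)"
  by (simp add: itinerary_def)

lemma length_itinerary [simp]: "length (itinerary T X n \<omega>) = n"
  by (simp add: itinerary_def)

text \<open>The kernel guesses each symbol \<open>X (T\<^sup>i \<omega>)\<close> from \<open>g\<close>, independently in \<open>i\<close>, keeping a
  small uniform weight for wrong guesses.\<close>


lemma entropy_rate_guess:
  fixes X :: "'b \<Rightarrow> 'c" and Y :: "'b \<Rightarrow> 'd"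
  assumes inv: "invariant_prob_measure T M" and X: "simple_function M X" and Y: "simple_function M Y"
    and err: "measure M {\<omega> \<in> space M. X \<omega> \<noteq> g (itinerary T Y N \<omega>)} \<le> e"
    and \<eta>: "0 < \<eta>" "\<eta> < 1"
  shows "entropy_rate T M X \<le> entropy_rate T M Y + (e * ln (card (X ` space M) / \<eta>) - ln (1 - \<eta>))"
proof -
  interpret prob_space M using inv by (simp add: invariant_prob_measure_def)
  have T: "T \<in> M \<rightarrow>\<^sub>M M" using inv by (simp add: invariant_prob_measure_def)
  define V where "V = X ` space M"
  define k where "k = real (card V)"
  have V: "finite V" using simple_functionD(1)[OF X] by (simp add: V_def)
  have "V \<noteq> {}" using not_empty by (simp add: V_def)
  then have k: "1 \<le> k" using V by (simp add: k_def Suc_le_eq card_gt_0_iff)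
  \<comment> \<open>\<open>c1\<close> bounds the price of a right guess; \<open>c2\<close> is the
    price of a wrong one, which only receives the uniform share \<open>\<eta> / k\<close>.\<close>
  define c1 c2 where "c1 = - ln (1 - \<eta>)" and "c2 = ln (k / \<eta>)"
  have c: "0 \<le> c1" "0 \<le> c2" using \<eta> k by (auto simp: c1_def c2_def)
  define q where "q v v' = (if v = v' then 1 - \<eta> else 0) + \<eta> / k" for v v' :: 'c
  have q0: "0 < q v v'" for v v' using \<eta> k by (auto simp: q_def intro!: add_nonneg_pos)
  have q1: "(\<Sum>v\<in>V. q v v') \<le> 1" for v'
  proof -
    have "(\<Sum>v\<in>V. q v v') = (\<Sum>v\<in>V. if v = v' then 1 - \<eta> else 0) + \<eta>"
      using k by (simp add: q_def sum.distrib k_def)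
    also have "\<dots> \<le> 1" using V \<eta> by simp
    finally show ?thesis .
  qed
  have q_ln: "- ln (q v v') \<le> c1 + (if v \<noteq> v' then c2 else 0)" for v v'
  proof (cases "v = v'")
    case True
    have "ln (1 - \<eta>) \<le> ln (q v v')" using True \<eta> k q0[of v v'] by (simp add: q_def)
    then show ?thesis using True by (simp add: c1_def)
  next
    case False
    have "- ln (q v v') = c2" using False \<eta> k by (simp add: q_def c2_def ln_div)
    then show ?thesis using False c by simp
  qed
  define W where "W = itinerary T Y N"
  define bad where "bad = {\<omega> \<in> space M. X \<omega> \<noteq> g (W \<omega>)}"
  have W: "simple_function M W" unfolding W_def by (rule simple_function_itinerary[OF Y T])
  have bad: "bad \<in> events"
  proof -
    have "bad = (\<lambda>\<omega>. (X \<omega>, W \<omega>)) -` {(v, w). v \<noteq> g w} \<inter> space M" by (auto simp: bad_def)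
    then show ?thesis by (simp only: simple_functionD(2)[OF simple_function_Pair[OF X W]])
  qed
  have Ti: "(T ^^ i) \<omega> \<in> space M" if "\<omega> \<in> space M" for i \<omega>
    using measurable_space[OF invariant_prob_measure_funpow(1)[OF inv]] that .
  have "shannon_entropy M (itinerary T X n)
      \<le> shannon_entropy M (itinerary T Y (n + N)) + ((e * c2 + c1) * n + 0)" for n
  proof -
    \<comment> \<open>The guess at time \<open>i\<close> reads the window of length \<open>N\<close>
      that starts at \<open>i\<close> in the \<open>Y\<close>-itinerary. The last windows reach
      beyond time \<open>n\<close>, which is why \<open>Y\<close> is observed up to
      \<open>n + N\<close>.\<close>
    define Q where "Q u w = (\<Prod>i<n. q (u ! i) (g (take N (drop i w))))" for u :: "'c list" and w :: "'d list"
    define f where "f \<omega> = (\<Sum>i<n. c1 + c2 * indicator ((T ^^ i) -` bad \<inter> space M) \<omega>)" for \<omega>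
    have Q0: "0 < Q u w" for u w unfolding Q_def by (intro prod_pos q0)
    have ev: "(T ^^ i) -` bad \<inter> space M \<in> events" for i
      using bad invariant_prob_measure_funpow(1)[OF inv] by (rule measurable_sets[rotated])
    have sub: "itinerary T X n ` space M \<subseteq> {u. set u \<subseteq> V \<and> length u = n}"
      using Ti by (auto simp: itinerary_def V_def)
    have drop: "take N (drop i (itinerary T Y (n + N) \<omega>)) = W ((T ^^ i) \<omega>)" if "i < n" for i \<omega>
      using that by (intro nth_equalityI) (auto simp: W_def nth_itinerary funpow_add[symmetric, THEN fun_cong, simplified] add.commute)
    have "shannon_entropy M (itinerary T X n) \<le> shannon_entropy M (itinerary T Y (n + N)) + (\<integral>\<omega>. f \<omega> \<partial>M)"
    proof (rule shannon_entropy_gibbs[where q=Q])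
      show "simple_function M (itinerary T X n)" "simple_function M (itinerary T Y (n + N))"
        by (intro simple_function_itinerary X Y T)+
      show "0 \<le> Q u w" "0 < Q u w" for u w using Q0[of u w] by simp_all
      show "(\<Sum>u\<in>itinerary T X n ` space M. Q u w) \<le> 1" for w
      proof -
        have "(\<Sum>u\<in>itinerary T X n ` space M. Q u w) \<le> (\<Sum>u\<in>{u. set u \<subseteq> V \<and> length u = n}. Q u w)"
          using finite_lists_length_eq[OF V] sub
          by (intro sum_mono2) (auto intro: less_imp_le[OF Q0])
        also have "\<dots> \<le> 1"
          unfolding Q_def using V q0 q1 by (intro sum_prod_lists_le_one) (auto intro: less_imp_le)
        finally show ?thesis .
      qed
      show "integrable M f"
        unfolding f_def using ev
        by (auto intro!: Bochner_Integration.integrable_sum Bochner_Integration.integrable_add integrable_real_indicator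
            simp: less_top[symmetric])
      fix \<omega> assume \<omega>: "\<omega> \<in> space M"
      have "- ln (Q (itinerary T X n \<omega>) (itinerary T Y (n + N) \<omega>))
          = (\<Sum>i<n. - ln (q (X ((T ^^ i) \<omega>)) (g (W ((T ^^ i) \<omega>)))))"
        unfolding Q_def using q0
        by (subst ln_prod) (auto simp: sum_negf[symmetric] nth_itinerary drop q0[THEN less_imp_neq, symmetric])
      also have "\<dots> \<le> f \<omega>"
        unfolding f_def
      proof (rule sum_mono)
        fix i
        have "X ((T ^^ i) \<omega>) \<noteq> g (W ((T ^^ i) \<omega>)) \<longleftrightarrow> \<omega> \<in> (T ^^ i) -` bad \<inter> space M"
          using \<omega> Ti by (auto simp: bad_def)
        then show "- ln (q (X ((T ^^ i) \<omega>)) (g (W ((T ^^ i) \<omega>))))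
            \<le> c1 + c2 * indicator ((T ^^ i) -` bad \<inter> space M) \<omega>"
          using q_ln[of "X ((T ^^ i) \<omega>)" "g (W ((T ^^ i) \<omega>))"] by (auto simp: indicator_def)
      qed
      finally show "- ln (Q (itinerary T X n \<omega>) (itinerary T Y (n + N) \<omega>)) \<le> f \<omega>" .
    qed
    \<comment> \<open>By invariance an error at time \<open>i\<close> is as likely as one at time 0,
      so the expected price is linear in \<open>n\<close>.\<close>
    also have "(\<integral>\<omega>. f \<omega> \<partial>M) = (\<Sum>i<n. c1 + c2 * prob bad)"
      unfolding f_def using ev
      by (subst Bochner_Integration.integral_sum)
        (auto intro!: Bochner_Integration.integrable_add sum.cong integrable_real_indicator
          simp: less_top[symmetric] prob_space measure_invariant[OF inv bad])
    also have "\<dots> \<le> (e * c2 + c1) * n + 0"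
    proof -
      have "c2 * prob bad * real n \<le> c2 * e * real n"
        using err c by (intro mult_right_mono mult_left_mono) (simp_all add: bad_def W_def)
      then show ?thesis by (simp add: algebra_simps)
    qed
    finally show ?thesis by simp
  qed
  then have "entropy_rate T M X \<le> entropy_rate T M Y + (e * c2 + c1)"
    by (rule entropy_rate_le_entropy_rate[OF inv X Y, where s="\<lambda>_. 0" and N=N]) simp
  then show ?thesis
    by (simp add: c1_def c2_def k_def V_def)
qed

section \<open>Borel sets and codings of Markov shifts\<close>

lemma space_markov_shift_borel [simp]: "space (markov_shift_borel S) = markov_shift_space S"
  and sets_markov_shift_borel_open:
    "sets (markov_shift_borel S) = sigma_sets (markov_shift_space S) {U. openin (markov_shift_topology S) U}"
proof -
  have "{U. openin (markov_shift_topology S) U} \<subseteq> Pow (markov_shift_space S)"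
    using openin_subset topspace_markov_shift_topology by fastforce
  then show "space (markov_shift_borel S) = markov_shift_space S"
    "sets (markov_shift_borel S) = sigma_sets (markov_shift_space S) {U. openin (markov_shift_topology S) U}"
    by (simp_all add: markov_shift_borel_def)
qed

lemma openin_cylinder: "openin (markov_shift_topology S) (cylinder S k w)"
  unfolding markov_shift_topology_def by (rule topology_generated_by_Basis) auto

lemma cylinder_map: "cylinder S 0 (map x [0..<n]) = {y \<in> markov_shift_space S. \<forall>i<n. y i = x i}"
  by (auto simp: cylinder_def)

text \<open>Generating cylinders may start at any position \<open>k\<close>; a prefix reaching the
  end of the prescribed block decides membership, so prefixes alone give a neighbourhood
  base.\<close>

lemma openin_markov_shift_cylinder:
  assumes "openin (markov_shift_topology S) U" "x \<in> U"
  obtains n where "cylinder S 0 (map x [0..<n]) \<subseteq> U"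
proof -
  have "generate_topology_on {cylinder S k w | k w. True} U"
    using assms(1) by (simp add: markov_shift_topology_def openin_topology_generated_by_iff)
  then have "\<forall>x\<in>U. \<exists>n. cylinder S 0 (map x [0..<n]) \<subseteq> U"
  proof induction
    case (Int a b)
    show ?case
    proof
      fix x assume x: "x \<in> a \<inter> b"
      then obtain m n where "cylinder S 0 (map x [0..<m]) \<subseteq> a" "cylinder S 0 (map x [0..<n]) \<subseteq> b"
        using Int by blast
      then have "cylinder S 0 (map x [0..<max m n]) \<subseteq> a \<inter> b"
        unfolding cylinder_map by auto
      then show "\<exists>n. cylinder S 0 (map x [0..<n]) \<subseteq> a \<inter> b" ..
    qed
  next
    case (UN K)
    then show ?case by (meson Union_iff Union_upper subset_trans)
  next
    case (Basis s)
    then obtain k w where s: "s = cylinder S k w" by auto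
    have "cylinder S 0 (map x [0..<k + length w]) \<subseteq> s" if "x \<in> s" for x
      using that unfolding cylinder_map s by (auto simp: cylinder_def)
    then show ?case by blast
  qed simp
  then show thesis using assms(2) that by blast
qed

text \<open>An open set is the union of the prefix cylinders inside it, and there are only countably
  many words. Here countability of the alphabet brings the open sets into the generated
  sigma-algebra.\<close>

lemma sets_markov_shift_borel:
  fixes S :: "'a :: countable \<Rightarrow> 'a \<Rightarrow> nat"
  shows "sets (markov_shift_borel S) = sigma_sets (markov_shift_space S) (range (cylinder S 0))"
  unfolding sets_markov_shift_borel_open
proof (rule sigma_sets_eqI)
  fix U assume "U \<in> {U. openin (markov_shift_topology S) U}"
  then have U: "openin (markov_shift_topology S) U" by simp
  define W where "W = {w. cylinder S 0 w \<subseteq> U}"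
  have "U = (\<Union>w\<in>W. cylinder S 0 w)"
  proof (intro equalityI subsetI)
    fix x assume x: "x \<in> U"
    then have xs: "x \<in> markov_shift_space S"
      using openin_subset[OF U] by (auto simp: topspace_markov_shift_topology)
    obtain n where "cylinder S 0 (map x [0..<n]) \<subseteq> U"
      by (rule openin_markov_shift_cylinder[OF U x])
    moreover have "x \<in> cylinder S 0 (map x [0..<n])"
      using xs by (simp add: cylinder_map)
    ultimately show "x \<in> (\<Union>w\<in>W. cylinder S 0 w)"
      unfolding W_def by blast
  qed (auto simp: W_def)
  moreover have "(\<Union>w\<in>W. cylinder S 0 w) \<in> sigma_sets (markov_shift_space S) (range (cylinder S 0))"
    by (intro sigma_sets_UNION) (auto simp: cylinder_def intro: sigma_sets.Basic)
  ultimately show "U \<in> sigma_sets (markov_shift_space S) (range (cylinder S 0))" by simp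
next
  fix A assume "A \<in> range (cylinder S 0)"
  then show "A \<in> sigma_sets (markov_shift_space S) {U. openin (markov_shift_topology S) U}"
    using openin_cylinder by (auto intro: sigma_sets.Basic)
qed

lemma measurable_markov_shift_borel:
  fixes S :: "'a :: countable \<Rightarrow> 'a \<Rightarrow> nat"
  assumes f: "f \<in> space M \<rightarrow> markov_shift_space S"
    and coord: "\<And>i. (\<lambda>\<omega>. f \<omega> i) \<in> M \<rightarrow>\<^sub>M count_space UNIV"
  shows "f \<in> M \<rightarrow>\<^sub>M markov_shift_borel S"
proof (rule measurable_sigma_sets[OF sets_markov_shift_borel])
  fix A assume "A \<in> range (cylinder S 0)"
  then obtain w where A: "A = cylinder S 0 w" by auto
  note [measurable] = coord
  have "f -` A \<inter> space M = {\<omega> \<in> space M. \<forall>j<length w. f \<omega> j = w ! j}"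
    using f by (auto simp: A cylinder_def)
  also have "\<dots> \<in> sets M" by measurable
  finally show "f -` A \<inter> space M \<in> sets M" .
qed (use f in \<open>auto simp: cylinder_def\<close>)

section \<open>Sets determined by finitely many coordinates\<close>

lemma openin_markov_shift_prefix:
  assumes "A \<subseteq> markov_shift_space S"
    and "\<And>x y. x \<in> A \<Longrightarrow> y \<in> markov_shift_space S \<Longrightarrow> \<forall>i<n. y i = x i \<Longrightarrow> y \<in> A"
  shows "openin (markov_shift_topology S) A"
proof -
  have "A = (\<Union>x\<in>A. cylinder S 0 (map x [0..<n]))"
  proof (intro equalityI subsetI)
    fix x assume "x \<in> A"
    then show "x \<in> (\<Union>x\<in>A. cylinder S 0 (map x [0..<n]))"
      using assms(1) unfolding cylinder_map by auto
  next
    fix y assume "y \<in> (\<Union>x\<in>A. cylinder S 0 (map x [0..<n]))"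
    then show "y \<in> A" using assms(2) unfolding cylinder_map by auto
  qed
  moreover have "openin (markov_shift_topology S) (\<Union>x\<in>A. cylinder S 0 (map x [0..<n]))"
    by (rule openin_Union) (auto simp: openin_cylinder)
  ultimately show ?thesis by simp
qed

lemma sets_markov_shift_prefix:
  assumes "A \<subseteq> markov_shift_space S"
    and "\<And>x y. x \<in> A \<Longrightarrow> y \<in> markov_shift_space S \<Longrightarrow> \<forall>i<n. y i = x i \<Longrightarrow> y \<in> A"
  shows "A \<in> sets (markov_shift_borel S)"
  using openin_markov_shift_prefix[OF assms] unfolding sets_markov_shift_borel_open
  by (auto intro: sigma_sets.Basic)

lemma measurable_markov_shift_coord: "(\<lambda>x. x i) \<in> markov_shift_borel S \<rightarrow>\<^sub>M count_space UNIV"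
proof (rule measurableI)
  fix A :: "'a set"
  show "(\<lambda>x. x i) -` A \<inter> space (markov_shift_borel S) \<in> sets (markov_shift_borel S)"
    by (rule sets_markov_shift_prefix[of _ _ "Suc i"]) auto
qed simp

lemma funpow_shift_map: "(shift_map ^^ n) x i = x (i + n)"
  by (induction n arbitrary: i) (simp_all add: shift_map_def)

lemma shift_map_markov_shift_space: "x \<in> markov_shift_space S \<Longrightarrow> shift_map x \<in> markov_shift_space S"
  by (simp add: markov_shift_space_def shift_map_def)

lemma funpow_shift_map_markov_shift_space:
  "x \<in> markov_shift_space S \<Longrightarrow> (shift_map ^^ n) x \<in> markov_shift_space S"
  by (induction n) (simp_all add: shift_map_markov_shift_space)

lemma measurable_shift_map:
  fixes S :: "'a :: countable \<Rightarrow> 'a \<Rightarrow> nat"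
  shows "shift_map \<in> markov_shift_borel S \<rightarrow>\<^sub>M markov_shift_borel S"
  by (rule measurable_markov_shift_borel)
    (simp_all add: shift_map_markov_shift_space, simp add: shift_map_def measurable_markov_shift_coord)

lemma simple_function_prefix:
  assumes "finite (f ` markov_shift_space S)"
    and "\<And>x y. x \<in> markov_shift_space S \<Longrightarrow> y \<in> markov_shift_space S \<Longrightarrow> \<forall>i<n. y i = x i \<Longrightarrow> f y = f x"
  shows "simple_function (markov_shift_borel S) f"
  unfolding simple_function_def
proof (intro conjI ballI)
  show "finite (f ` space (markov_shift_borel S))" using assms(1) by simp
  fix v
  show "f -` {v} \<inter> space (markov_shift_borel S) \<in> sets (markov_shift_borel S)"
  proof (rule sets_markov_shift_prefix[of _ _ n])
    fix x y assume x: "x \<in> f -` {v} \<inter> space (markov_shift_borel S)"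
      and y: "y \<in> markov_shift_space S" "\<forall>i<n. y i = x i"
    then have "f y = f x" by (intro assms(2)) simp_all
    then show "y \<in> f -` {v} \<inter> space (markov_shift_borel S)" using x y by simp
  qed simp
qed

text \<open>Dependence on the first \<open>n\<close> coordinates is inherited by the complement, so
  \<open>A\<close> is clopen and its indicator is a bounded continuous test function.
  \<open>A\<close> may be a union of infinitely many cylinders, as sets avoiding a given letter can
  be.\<close>

lemma weak_star_tendsto_prefix:
  assumes lim: "weak_star_tendsto S \<mu>s \<mu>"
    and sets: "\<And>k. sets (\<mu>s k) = sets (markov_shift_borel S)" "sets \<mu> = sets (markov_shift_borel S)"
    and A: "A \<subseteq> markov_shift_space S"
      "\<And>x y. x \<in> A \<Longrightarrow> y \<in> markov_shift_space S \<Longrightarrow> \<forall>i<n. y i = x i \<Longrightarrow> y \<in> A"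
  shows "(\<lambda>k. measure (\<mu>s k) A) \<longlonglongrightarrow> measure \<mu> A"
proof -
  have o1: "openin (markov_shift_topology S) A"
    by (rule openin_markov_shift_prefix[OF A])
  have o2: "openin (markov_shift_topology S) (markov_shift_space S - A)"
  proof (rule openin_markov_shift_prefix[of _ _ n])
    fix x y assume x: "x \<in> markov_shift_space S - A" and y: "y \<in> markov_shift_space S" and eq: "\<forall>i<n. y i = x i"
    have "x \<in> A" if "y \<in> A" using A(2)[OF that] x eq by auto
    then show "y \<in> markov_shift_space S - A" using x y by blast
  qed blast
  have "continuous_map (markov_shift_topology S) euclideanreal (indicator A)"
    unfolding continuous_map topspace_markov_shift_topology
  proof (intro conjI allI impI)
    fix U :: "real set"
    have "{x \<in> markov_shift_space S. indicator A x \<in> U}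
        = (if 1 \<in> U then A else {}) \<union> (if 0 \<in> U then markov_shift_space S - A else {})"
      using A(1) by (auto simp: indicator_def)
    then show "openin (markov_shift_topology S) {x \<in> markov_shift_space S. indicator A x \<in> U}"
      using o1 o2 by (simp only:) (intro openin_Un; simp)
  qed simp
  moreover have "bounded ((indicator A :: _ \<Rightarrow> real) ` markov_shift_space S)"
    by (rule boundedI[of _ 1]) (auto simp: indicator_def)
  ultimately have "(\<lambda>k. \<integral>x. indicat_real A x \<partial>\<mu>s k) \<longlonglongrightarrow> (\<integral>x. indicat_real A x \<partial>\<mu>)"
    using lim unfolding weak_star_tendsto_def by blast
  moreover have "space (\<mu>s k) = markov_shift_space S" "space \<mu> = markov_shift_space S" for k
    using sets_eq_imp_space_eq[OF sets(1)] sets_eq_imp_space_eq[OF sets(2)] by simp_all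
  ultimately show ?thesis using A(1) by (simp add: Int_absorb2)
qed

section \<open>Finite codes and approximation by them\<close>

text \<open>All letters outside \<open>G\<close> are merged into \<open>None\<close>, so that a
  finite \<open>G\<close> gives a finite partition even over an infinite alphabet.\<close>

definition letter_code :: "'a set \<Rightarrow> (nat \<Rightarrow> 'a) \<Rightarrow> 'a option" where
  "letter_code G x = (if x 0 \<in> G then Some (x 0) else None)"

text \<open>These are the unions of fibres of the code itinerary of length \<open>N\<close>. Keeping
  \<open>G\<close> and \<open>N\<close> as parameters allows finitely many such sets to be brought
  to a common code by enlarging both.\<close>

definition code_determined :: "('a \<Rightarrow> 'a \<Rightarrow> nat) \<Rightarrow> 'a set \<Rightarrow> nat \<Rightarrow> (nat \<Rightarrow> 'a) set \<Rightarrow> bool" where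
  "code_determined S G N A \<longleftrightarrow> A \<subseteq> markov_shift_space S \<and>
     (\<forall>x\<in>A. \<forall>y\<in>markov_shift_space S.
        itinerary shift_map (letter_code G) N y = itinerary shift_map (letter_code G) N x \<longrightarrow> y \<in> A)"

lemma itinerary_letter_code_eq_iff:
  "itinerary shift_map (letter_code G) N y = itinerary shift_map (letter_code G) N x \<longleftrightarrow>
   (\<forall>i<N. (y i \<in> G \<or> x i \<in> G) \<longrightarrow> y i = x i)"
proof -
  have "(if a \<in> G then Some a else None) = (if b \<in> G then Some b else None) \<longleftrightarrow>
      (a \<in> G \<or> b \<in> G \<longrightarrow> a = b)" for a b
    by (cases "a = b") auto
  then show ?thesis
    by (simp add: itinerary_def letter_code_def funpow_shift_map Ball_def split del: if_split cong: if_cong)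
qed

lemma simple_function_letter_code:
  assumes "finite G"
  shows "simple_function (markov_shift_borel S) (letter_code G)"
proof (rule simple_function_prefix[of _ _ 1])
  show "finite (letter_code G ` markov_shift_space S)"
    by (rule finite_subset[of _ "insert None (Some ` G)"]) (use assms in \<open>auto simp: letter_code_def\<close>)
qed (simp add: letter_code_def)

lemma code_determined_mono:
  assumes "code_determined S G N A" "G \<subseteq> G'" "N \<le> N'"
  shows "code_determined S G' N' A"
  unfolding code_determined_def itinerary_letter_code_eq_iff
proof (intro conjI ballI impI)
  show "A \<subseteq> markov_shift_space S" using assms(1) by (simp add: code_determined_def)
  fix x y assume x: "x \<in> A" and y: "y \<in> markov_shift_space S"
    and eq: "\<forall>i<N'. y i \<in> G' \<or> x i \<in> G' \<longrightarrow> y i = x i"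
  have "\<forall>i<N. y i \<in> G \<or> x i \<in> G \<longrightarrow> y i = x i"
    using eq assms(2,3) by (meson less_le_trans subsetD)
  with assms(1) x y show "y \<in> A"
    unfolding code_determined_def itinerary_letter_code_eq_iff by blast
qed

lemma code_determined_Compl:
  assumes "code_determined S G N A"
  shows "code_determined S G N (markov_shift_space S - A)"
  unfolding code_determined_def
proof (intro conjI ballI impI)
  fix x y assume x: "x \<in> markov_shift_space S - A" and y: "y \<in> markov_shift_space S"
    and eq: "itinerary shift_map (letter_code G) N y = itinerary shift_map (letter_code G) N x"
  have "x \<in> A" if "y \<in> A"
    using assms that x eq[symmetric] unfolding code_determined_def by blast
  then show "y \<in> markov_shift_space S - A" using x y by blast
qed blast

lemma code_determined_UN:
  assumes "\<And>i. i \<in> I \<Longrightarrow> code_determined S (G i) (N i) (A i)" and I: "finite I"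
  shows "code_determined S (\<Union>i\<in>I. G i) (\<Sum>i\<in>I. N i) (\<Union>i\<in>I. A i)"
proof -
  have "code_determined S (\<Union>i\<in>I. G i) (\<Sum>i\<in>I. N i) (A i)" if "i \<in> I" for i
  proof (rule code_determined_mono[OF assms(1)[OF that]])
    show "N i \<le> (\<Sum>i\<in>I. N i)" using that I by (intro member_le_sum) simp_all
  qed (use that in blast)
  then show ?thesis unfolding code_determined_def by blast
qed

lemma code_determined_cylinder: "code_determined S (set w) (length w) (cylinder S 0 w)"
  unfolding code_determined_def itinerary_letter_code_eq_iff
proof (intro conjI ballI impI)
  fix x y assume x: "x \<in> cylinder S 0 w" and y: "y \<in> markov_shift_space S"
    and eq: "\<forall>i<length w. y i \<in> set w \<or> x i \<in> set w \<longrightarrow> y i = x i"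
  have "y j = w ! j" if "j < length w" for j
  proof -
    have "x j = w ! j" using x that by (simp add: cylinder_def)
    then show ?thesis using eq that nth_mem[OF that] by metis
  qed
  then show "y \<in> cylinder S 0 w" using y by (simp add: cylinder_def)
qed (auto simp: cylinder_def)

lemma code_determined_sets:
  assumes "code_determined S G N A"
  shows "A \<in> sets (markov_shift_borel S)"
proof (rule sets_markov_shift_prefix[of _ _ N])
  show "A \<subseteq> markov_shift_space S" using assms by (simp add: code_determined_def)
  fix x y assume "x \<in> A" "y \<in> markov_shift_space S" "\<forall>i<N. y i = x i"
  then show "y \<in> A" using assms unfolding code_determined_def itinerary_letter_code_eq_iff by blast
qed

text \<open>The sets that can be approximated in measure contain the cylinders and are closed under
  complements and countable unions. \<open>G\<close> depends on the set, the error and the measure;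
  this is harmless because \<open>G\<close> is absent from the final entropy bound.\<close>

lemma approx_code_determined:
  fixes S :: "'a :: countable \<Rightarrow> 'a \<Rightarrow> nat" and M :: "(nat \<Rightarrow> 'a) measure"
  assumes M: "prob_space M" and sets: "sets M = sets (markov_shift_borel S)"
    and B: "B \<in> sets M" and e: "0 < e"
  shows "\<exists>G N A. finite G \<and> code_determined S G N A \<and> measure M ((B - A) \<union> (A - B)) < e"
proof -
  interpret prob_space M by (rule M)
  have ev: "A \<in> events" if "code_determined S G N A" for G N A
    using code_determined_sets[OF that] sets by simp
  have "B \<in> sigma_sets (markov_shift_space S) (range (cylinder S 0))"
    using B sets sets_markov_shift_borel[of S] by simp
  then show ?thesis
    using e
  proof (induction arbitrary: e)
    case (Basic a)
    then obtain w where "a = cylinder S 0 w" by auto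
    then show ?case using code_determined_cylinder[of S w] Basic.prems
      by (intro exI[of _ "set w"] exI[of _ "length w"] exI[of _ a]) simp
  next
    case Empty
    then show ?case by (intro exI[of _ "{}"] exI[of _ 0] exI[of _ "{}"]) (simp add: code_determined_def)
  next
    case (Compl a)
    from Compl.IH[OF Compl.prems] obtain G N A where A: "finite G" "code_determined S G N A"
      "prob ((a - A) \<union> (A - a)) < e" by blast
    have "a \<subseteq> markov_shift_space S" using Compl.hyps sigma_sets_into_sp[of "range (cylinder S 0)" "markov_shift_space S"]
      by (auto simp: cylinder_def)
    moreover have "A \<subseteq> markov_shift_space S" using A by (simp add: code_determined_def)
    ultimately have "((markov_shift_space S - a) - (markov_shift_space S - A)) \<union>
        ((markov_shift_space S - A) - (markov_shift_space S - a)) = (a - A) \<union> (A - a)" by blast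
    then show ?case using A code_determined_Compl[OF A(2)] by metis
  next
    case (Union a)
    have a: "a i \<in> events" for i
      using Union.hyps sets sets_markov_shift_borel[of S] by simp
    define U where "U n = (\<Union>i<n. a i)" for n
    have UU: "(\<Union>n. U n) = (\<Union>i. a i)" by (auto simp: U_def)
    have "(\<lambda>n. prob (U n)) \<longlonglongrightarrow> prob (\<Union>n. U n)"
      by (rule finite_Lim_measure_incseq) (use a in \<open>auto simp: U_def incseq_def intro!: sets.finite_UN\<close>, force)
    then have "\<forall>\<^sub>F n in sequentially. prob (\<Union>i. a i) - e / 2 < prob (U n)"
      using Union.prems unfolding UU by (intro order_tendstoD(1)) auto
    \<comment> \<open>The union is cut off after \<open>K\<close> sets, at a loss below
      \<open>e / 2\<close>; these \<open>K\<close> sets share the other half. Dividing by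
      \<open>Suc K\<close> keeps the share positive for \<open>K = 0\<close>.\<close>
    then obtain K where K: "prob (\<Union>i. a i) - e / 2 < prob (U K)"
      by (auto simp: eventually_sequentially)
    have "\<exists>G N A. finite G \<and> code_determined S G N A \<and> prob ((a i - A) \<union> (A - a i)) < e / 2 / Suc K" for i
      using Union.prems by (intro Union.IH) simp
    then obtain G N A where A: "\<And>i. finite (G i)" "\<And>i. code_determined S (G i) (N i) (A i)"
      "\<And>i. prob ((a i - A i) \<union> (A i - a i)) < e / 2 / Suc K" by metis
    define A' where "A' = (\<Union>i<K. A i)"
    define D where "D i = (a i - A i) \<union> (A i - a i)" for i
    have D: "D i \<in> events" for i using a ev[OF A(2)] by (auto simp: D_def)
    have "prob (\<Union>i<K. D i) \<le> (\<Sum>i<K. prob (D i))"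
      using D by (intro finite_measure_subadditive_finite) auto
    also have "\<dots> \<le> (\<Sum>i<K. e / 2 / Suc K)"
      using A(3) by (intro sum_mono) (simp add: D_def less_imp_le)
    also have "\<dots> \<le> e / 2" using Union.prems by (simp add: field_simps)
    finally have 1: "prob (\<Union>i<K. D i) \<le> e / 2" .
    have UK: "U K \<in> events" "(\<Union>i. a i) \<in> events" using a by (auto simp: U_def)
    have "prob ((\<Union>i. a i) - U K) = prob (\<Union>i. a i) - prob (U K)"
      using UK by (intro finite_measure_Diff) (auto simp: U_def)
    then have 2: "prob ((\<Union>i. a i) - U K) < e / 2" using K by simp
    have "prob (((\<Union>i. a i) - A') \<union> (A' - (\<Union>i. a i))) \<le> prob (((\<Union>i. a i) - U K) \<union> (\<Union>i<K. D i))"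
    proof (rule finite_measure_mono)
      show "((\<Union>i. a i) - A') \<union> (A' - (\<Union>i. a i)) \<subseteq> ((\<Union>i. a i) - U K) \<union> (\<Union>i<K. D i)"
        unfolding A'_def U_def D_def by blast
    qed (use UK D in auto)
    also have "\<dots> \<le> prob ((\<Union>i. a i) - U K) + prob (\<Union>i<K. D i)"
      using UK D by (intro measure_Un_le) auto
    also have "\<dots> < e" using 1 2 by simp
    finally have "prob (((\<Union>i. a i) - A') \<union> (A' - (\<Union>i. a i))) < e" .
    moreover have "code_determined S (\<Union>i<K. G i) (\<Sum>i<K. N i) A'"
      unfolding A'_def using A(2) by (intro code_determined_UN) auto
    moreover have "finite (\<Union>i<K. G i)" using A(1) by simp
    ultimately show ?case by blast
  qed
qed

lemma simple_function_guess_from_code: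
  fixes S :: "'a :: countable \<Rightarrow> 'a \<Rightarrow> nat" and M :: "(nat \<Rightarrow> 'a) measure"
  assumes M: "prob_space M" and sets: "sets M = sets (markov_shift_borel S)"
    and X: "simple_function M X" and e: "0 < e"
  obtains G N g where "finite G"
    "measure M {x \<in> space M. X x \<noteq> g (itinerary shift_map (letter_code G) N x)} \<le> e"
proof -
  interpret prob_space M by (rule M)
  have sp: "space M = markov_shift_space S"
    using sets_eq_imp_space_eq[OF sets] by simp
  define V where "V = X ` space M"
  have V: "finite V" using simple_functionD(1)[OF X] by (simp add: V_def)
  define B where "B v = X -` {v} \<inter> space M" for v
  have B: "B v \<in> events" for v using simple_functionD(2)[OF X] by (simp add: B_def)
  have "\<exists>G N A. finite G \<and> code_determined S G N A \<and> prob ((B v - A) \<union> (A - B v)) < e / Suc (card V)" for v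
    using e by (intro approx_code_determined[OF M sets B]) simp
  then obtain G' N' A where A: "\<And>v. finite (G' v)" "\<And>v. code_determined S (G' v) (N' v) (A v)"
    "\<And>v. prob ((B v - A v) \<union> (A v - B v)) < e / Suc (card V)" by metis
  define G N where "G = (\<Union>v\<in>V. G' v)" and "N = (\<Sum>v\<in>V. N' v)"
  have G: "finite G" using A(1) V by (simp add: G_def)
  have det: "code_determined S G N (A v)" if "v \<in> V" for v
  proof (rule code_determined_mono[OF A(2)[of v]])
    show "N' v \<le> N" unfolding N_def using that V by (intro member_le_sum) simp_all
  qed (use that in \<open>auto simp: G_def\<close>)
  let ?w = "itinerary shift_map (letter_code G) N"
  define D where "D v = (B v - A v) \<union> (A v - B v)" for v
  have D: "D v \<in> events" if "v \<in> V" for v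
    using B[of v] code_determined_sets[OF det[OF that]] sets by (auto simp: D_def)
  \<comment> \<open>A code word is decoded to the unique \<open>v\<close> whose set
    \<open>A v\<close> contains a point with that code. Where no \<open>v\<close> or several
    qualify, \<open>THE\<close> gives an arbitrary value, but such points lie in some
    \<open>D v\<close> and count as errors.\<close>
  define g where "g w = (THE v. v \<in> V \<and> w \<in> ?w ` A v)" for w
  have g: "g (?w x) = X x" if x: "x \<in> space M" "x \<notin> (\<Union>v\<in>V. D v)" for x
    unfolding g_def
  proof (rule the_equality)
    have mem: "x \<in> A v \<longleftrightarrow> X x = v" if "v \<in> V" for v
    proof -
      have "x \<notin> D v" using that x(2) by blast
      then have "x \<in> A v \<longleftrightarrow> x \<in> B v" unfolding D_def by blast
      then show ?thesis using x(1) by (simp add: B_def)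
    qed
    have XV: "X x \<in> V" using x by (simp add: V_def)
    show "X x \<in> V \<and> ?w x \<in> ?w ` A (X x)" using mem[OF XV] XV by blast
    fix v assume v: "v \<in> V \<and> ?w x \<in> ?w ` A v"
    then obtain y where "y \<in> A v" "?w x = ?w y" by blast
    then have "x \<in> A v" using det[of v] v x(1) unfolding code_determined_def sp by blast
    then show "v = X x" using mem v by blast
  qed
  have "prob {x \<in> space M. X x \<noteq> g (?w x)} \<le> prob (\<Union>v\<in>V. D v)"
  proof (rule finite_measure_mono)
    show "{x \<in> space M. X x \<noteq> g (?w x)} \<subseteq> (\<Union>v\<in>V. D v)"
      using g by fastforce
  qed (use D V in blast)
  also have "\<dots> \<le> (\<Sum>v\<in>V. prob (D v))"
    using D V by (intro finite_measure_subadditive_finite) auto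
  also have "\<dots> \<le> (\<Sum>v\<in>V. e / Suc (card V))"
    using A(3) by (intro sum_mono) (simp add: D_def less_imp_le)
  also have "\<dots> \<le> e" using e by (simp add: field_simps)
  finally show thesis using that G by blast
qed

lemma entropy_rate_le_letter_code:
  fixes S :: "'a :: countable \<Rightarrow> 'a \<Rightarrow> nat" and M :: "(nat \<Rightarrow> 'a) measure"
  assumes inv: "invariant_prob_measure shift_map M" and sets: "sets M = sets (markov_shift_borel S)"
    and X: "simple_function M X" and d: "0 < d"
  obtains G where "finite G" "entropy_rate shift_map M X \<le> entropy_rate shift_map M (letter_code G) + d"
proof -
  have M: "prob_space M" using inv by (simp add: invariant_prob_measure_def)
  define k where "k = real (card (X ` space M))"
  have "X ` space M \<noteq> {}" using prob_space.not_empty[OF M] by simp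
  then have k: "1 \<le> k" using simple_functionD(1)[OF X] by (simp add: k_def Suc_le_eq card_gt_0_iff)
  \<comment> \<open>The allowed loss \<open>d\<close> is halved: this \<eta> makes
    \<open>- ln (1 - \<eta>) = d / 2\<close>, and the error probability \<open>e\<close> chosen
    below makes \<open>e * L = d / 2\<close>.\<close>
  define \<eta> where "\<eta> = 1 - exp (- (d / 2))"
  have \<eta>: "0 < \<eta>" "\<eta> < 1" using d by (auto simp: \<eta>_def)
  define L where "L = ln (k / \<eta>)"
  have L: "0 < L" unfolding L_def using k \<eta> by (intro ln_gt_zero) (simp add: field_simps)
  define e where "e = d / 2 / L"
  have e: "0 < e" using d L by (simp add: e_def)
  obtain G N g where G: "finite G"
    "measure M {x \<in> space M. X x \<noteq> g (itinerary shift_map (letter_code G) N x)} \<le> e"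
    using simple_function_guess_from_code[OF M sets X e] .
  have Y: "simple_function M (letter_code G)"
    using simple_function_letter_code[OF G(1), of S] sets sets_eq_imp_space_eq[OF sets]
    by (simp add: simple_function_def)
  have "entropy_rate shift_map M X \<le> entropy_rate shift_map M (letter_code G) + (e * L - ln (1 - \<eta>))"
    using entropy_rate_guess[OF inv X Y G(2) \<eta>] by (simp add: L_def k_def)
  also have "e * L - ln (1 - \<eta>) = d" using L by (simp add: e_def \<eta>_def)
  finally show thesis using that G(1) by blast
qed

section \<open>Counting orbits with a given finite coding\<close>

text \<open>The final \<open>a\<close> is left off, so that loops can be concatenated without
  repeating it. Visits to \<open>a\<close> in between are allowed.\<close>

definition loops :: "('a \<Rightarrow> 'a \<Rightarrow> nat) \<Rightarrow> 'a \<Rightarrow> nat \<Rightarrow> 'a list set" where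
  "loops S a l = {map x [0..<l] | x. x \<in> markov_shift_space S \<and> x 0 = a \<and> x l = a}"

lemma map_upt_in_loops:
  assumes "x \<in> markov_shift_space S" "x p = a" "x q = a" "p \<le> q"
  shows "map x [p..<q] \<in> loops S a (q - p)"
proof -
  have "map x [p..<q] = map ((shift_map ^^ p) x) [0..<q - p]"
    by (rule nth_equalityI) (simp_all add: funpow_shift_map add.commute)
  moreover have "(shift_map ^^ p) x 0 = a" "(shift_map ^^ p) x (q - p) = a"
    using assms by (simp_all add: funpow_shift_map)
  ultimately show ?thesis
    using funpow_shift_map_markov_shift_space[OF assms(1), of p] unfolding loops_def by blast
qed

text \<open>Between two consecutive visits to \<open>a\<close> at distance at most \<open>2 * T\<close> the word is determined
  by its \<open>F\<close>-code; otherwise the position \<open>i\<close> has no visit in one of the windows \<open>{i - T<..i}\<close>,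
  \<open>{i<..i + T}\<close> and pays \<open>h\<close>. Positions before the first or after the last visit pay the maximal
  price \<open>ln (Suc (card G))\<close>.\<close>

definition ambiguity :: "'a \<Rightarrow> nat \<Rightarrow> real \<Rightarrow> real \<Rightarrow> nat \<Rightarrow> (nat \<Rightarrow> 'a) \<Rightarrow> nat \<Rightarrow> real" where
  "ambiguity a T h k n x i =
     k * (of_bool (\<forall>j\<le>i. x j \<noteq> a) + of_bool (\<forall>j. i < j \<and> j < n \<longrightarrow> x j \<noteq> a)) +
     h * (of_bool (T \<le> i \<and> (\<forall>j. i - T < j \<and> j \<le> i \<longrightarrow> x j \<noteq> a)) +
          of_bool (\<forall>j. i < j \<and> j \<le> i + T \<longrightarrow> x j \<noteq> a))"

text \<open>The time interval is cut at the visits to \<open>a\<close>. The logarithm of the number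
  of possible words is subadditive under cutting, so each piece is bounded alone. Only the two end
  pieces are bounded in terms of \<open>G\<close>.\<close>

lemma ln_card_compatible_codes_le:
  fixes S :: "'a \<Rightarrow> 'a \<Rightarrow> nat" and n :: nat
  assumes x: "x \<in> markov_shift_space S" and G: "finite G"
    and h: "0 \<le> h" and loops: "\<And>l. 0 < l \<Longrightarrow> finite (loops S a l) \<and> card (loops S a l) \<le> exp (h * l)"
    and F: "a \<in> F" "\<And>l. l \<le> 2 * T \<Longrightarrow> \<Union> (set ` loops S a l) \<subseteq> F"
  defines "A \<equiv> itinerary shift_map (letter_code G) n ` {y \<in> markov_shift_space S.
      itinerary shift_map (letter_code F) n y = itinerary shift_map (letter_code F) n x}"
  shows "finite A" and "ln (card A) \<le> (\<Sum>i<n. ambiguity a T h (ln (Suc (card G))) n x i)"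
proof -
  define code where "code u = (if u \<in> G then Some u else None)" for u
  define Y where "Y = {y \<in> markov_shift_space S. \<forall>i<n. y i \<in> F \<or> x i \<in> F \<longrightarrow> y i = x i}"
  \<comment> \<open>The \<open>G\<close>-code words on \<open>{p..<q}\<close> of all points that
    share the \<open>F\<close>-code of \<open>x\<close> on the whole of \<open>{..<n}\<close>, not
    just on this interval.\<close>
  define B where "B p q = (\<lambda>y. map (\<lambda>i. code (y i)) [p..<q]) ` Y" for p q
  define k where "k = ln (Suc (card G))"
  have k: "0 \<le> k" by (simp add: k_def)
  have A: "A = B 0 n"
    unfolding A_def B_def Y_def itinerary_letter_code_eq_iff
    by (intro image_cong refl) (simp add: itinerary_def letter_code_def funpow_shift_map code_def)
  have xY: "x \<in> Y" using x by (simp add: Y_def)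
  let ?C = "insert None (Some ` G)"
  have B_sub: "B p q \<subseteq> {u. set u \<subseteq> ?C \<and> length u = q - p}" for p q
    by (auto simp: B_def code_def)
  have fin: "finite (B p q)" for p q
    by (rule finite_subset[OF B_sub finite_lists_length_eq]) (use G in simp)
  have pos: "0 < card (B p q)" for p q
    using fin xY by (auto simp: card_gt_0_iff B_def)
  have cardC: "card ?C = Suc (card G)"
    using G by (subst card_insert_disjoint) (auto simp: card_image)
  have trivial: "ln (card (B p q)) \<le> k * (real q - real p)" if "p \<le> q" for p q
  proof -
    have "card (B p q) \<le> Suc (card G) ^ (q - p)"
      using card_mono[OF _ B_sub[of p q]] finite_lists_length_eq[of ?C "q - p"] card_lists_length_eq[of ?C "q - p"] G cardC
      by simp
    then have "ln (card (B p q)) \<le> ln (real (Suc (card G)) ^ (q - p))"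
      using pos[of p q] by (simp only: ln_le_cancel_iff of_nat_0_less_iff zero_less_power zero_less_Suc of_nat_le_iff of_nat_power[symmetric])
    also have "\<dots> = k * (real q - real p)" using that by (subst ln_realpow) (simp_all add: k_def of_nat_diff)
    finally show ?thesis .
  qed
  have split: "ln (card (B p q)) \<le> ln (card (B p r)) + ln (card (B r q))" if "p \<le> r" "r \<le> q" for p q r
  proof -
    have "[p..<q] = [p..<r] @ [r..<q]"
      using that by (metis le_Suc_ex upt_add_eq_append)
    then have "B p q \<subseteq> (\<lambda>(u, v). u @ v) ` (B p r \<times> B r q)"
      by (auto simp: B_def)
    then have "card (B p q) \<le> card (B p r) * card (B r q)"
      using fin surj_card_le[of "B p r \<times> B r q" "B p q"] by (simp add: card_cartesian_product)
    then have "real (card (B p q)) \<le> real (card (B p r)) * real (card (B r q))"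
      by (metis of_nat_le_iff of_nat_mult)
    then have "ln (card (B p q)) \<le> ln (real (card (B p r)) * real (card (B r q)))"
      using pos by (subst ln_le_cancel_iff) auto
    then show ?thesis using pos by (subst (asm) ln_mult) auto
  qed
  \<comment> \<open>As \<open>a\<close> belongs to \<open>F\<close>, the visits of \<open>x\<close>
    are visible in the \<open>F\<close>-code, so every member of \<open>Y\<close> visits
    \<open>a\<close> at the same cutting times. This is what turns the pieces into loops for all of
    them.\<close>
  have visit: "y i = a" if "y \<in> Y" "i < n" "x i = a" for y i
    using that F(1) by (auto simp: Y_def)
  have loop: "ln (card (B p q)) \<le> h * (real q - real p)" if "p < q" "q < n" "x p = a" "x q = a" for p q
  proof -
    have "B p q \<subseteq> map code ` loops S a (q - p)"
    proof
      fix u assume "u \<in> B p q"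
      then obtain y where y: "y \<in> Y" "u = map code (map y [p..<q])" by (auto simp: B_def)
      have "map y [p..<q] \<in> loops S a (q - p)"
      proof (rule map_upt_in_loops)
        show "y \<in> markov_shift_space S" using y(1) by (simp add: Y_def)
        show "y p = a" "y q = a" using that visit[OF y(1), of p] visit[OF y(1), of q] by simp_all
      qed (use that in simp)
      then show "u \<in> map code ` loops S a (q - p)" using y(2) by blast
    qed
    then have "card (B p q) \<le> card (loops S a (q - p))"
      using loops[of "q - p"] that by (intro surj_card_le) auto
    then have "card (B p q) \<le> exp (h * (q - p))"
      using loops[of "q - p"] that by (simp add: of_nat_diff)
    then have "ln (card (B p q)) \<le> ln (exp (h * (q - p)))"
      using pos[of p q] by (subst ln_le_cancel_iff) auto
    then show ?thesis using that by (simp add: of_nat_diff)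
  qed
  \<comment> \<open>A short loop of \<open>x\<close> runs inside \<open>F\<close>, so its code shows
    every letter and each member of \<open>Y\<close> agrees with \<open>x\<close> there: one word
    remains.\<close>
  have short: "ln (card (B p q)) \<le> 0" if "p < q" "q < n" "x p = a" "x q = a" "q - p \<le> 2 * T" for p q
  proof -
    have "map x [p..<q] \<in> loops S a (q - p)"
      using that by (intro map_upt_in_loops[OF x]) simp_all
    then have xF: "x i \<in> F" if "i \<in> {p..<q}" for i
    proof -
      have "x i \<in> set (map x [p..<q])" using that by simp
      then show ?thesis using F(2)[OF \<open>q - p \<le> 2 * T\<close>] \<open>map x [p..<q] \<in> loops S a (q - p)\<close> by blast
    qed
    have "B p q \<subseteq> {map (\<lambda>i. code (x i)) [p..<q]}"
    proof
      fix u assume "u \<in> B p q"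
      then obtain y where y: "y \<in> Y" "u = map (\<lambda>i. code (y i)) [p..<q]" by (auto simp: B_def)
      have "y i = x i" if "i \<in> {p..<q}" for i
      proof -
        have "i < n" using that \<open>q < n\<close> by simp
        then show ?thesis using y(1) xF[OF that] unfolding Y_def by blast
      qed
      then show "u \<in> {map (\<lambda>i. code (x i)) [p..<q]}" using y(2) by simp
    qed
    then have "card (B p q) \<le> 1" using card_mono[of "{map (\<lambda>i. code (x i)) [p..<q]}"] by simp
    then show ?thesis using pos[of p q] by (simp add: le_Suc_eq)
  qed
  define w where "w = ambiguity a T h k n x"
  have w0: "0 \<le> w i" for i unfolding w_def ambiguity_def using k h by (intro add_nonneg_nonneg mult_nonneg_nonneg) auto
  have w_before: "k \<le> w i" if "\<forall>j\<le>i. x j \<noteq> a" for i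
    unfolding w_def ambiguity_def using k h that by (simp add: distrib_left)
  have w_after: "k \<le> w i" if "\<forall>j. i < j \<and> j < n \<longrightarrow> x j \<noteq> a" for i
    unfolding w_def ambiguity_def using k h that by (simp add: distrib_left)
  have w_left: "h \<le> w i" if "T \<le> i" "\<forall>j. i - T < j \<and> j \<le> i \<longrightarrow> x j \<noteq> a" for i
    unfolding w_def ambiguity_def using k h that by (simp add: distrib_left)
  have w_right: "h \<le> w i" if "\<forall>j. i < j \<and> j \<le> i + T \<longrightarrow> x j \<noteq> a" for i
    unfolding w_def ambiguity_def using k h that by (simp add: distrib_left)
  have const: "c * (real q - real p) \<le> (\<Sum>i\<in>{p..<q}. w i)" if "p \<le> q" "\<And>i. i \<in> {p..<q} \<Longrightarrow> c \<le> w i" for c p q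
    using sum_bounded_below[of "{p..<q}" c w] that by (simp add: of_nat_diff mult.commute)
  have join: "(\<Sum>i\<in>{p..<q}. w i) + (\<Sum>i\<in>{q..<r}. w i) = (\<Sum>i\<in>{p..<r}. w i)" if "p \<le> q" "q \<le> r" for p q r
    using that by (rule sum.atLeastLessThan_concat)
  have from_visit: "ln (card (B p n)) \<le> (\<Sum>i\<in>{p..<n}. w i)" if "p < n" "x p = a" for p
    using that
  proof (induction "n - p" arbitrary: p rule: less_induct)
    case less
    show ?case
    proof (cases "\<exists>q. p < q \<and> q < n \<and> x q = a")
      case False
      then have "k * (real n - real p) \<le> (\<Sum>i\<in>{p..<n}. w i)"
        using less.prems by (intro const w_after) auto
      then show ?thesis using trivial[of p n] less.prems by linarith
    next
      case True
      define q where "q = (LEAST q. p < q \<and> q < n \<and> x q = a)"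
      have q: "p < q" "q < n" "x q = a" using LeastI_ex[OF True] by (simp_all add: q_def)
      have no: "x j \<noteq> a" if "p < j" "j < q" for j
        using that not_less_Least[of j "\<lambda>q. p < q \<and> q < n \<and> x q = a"] q(2) by (auto simp: q_def)
      have "ln (card (B p q)) \<le> (\<Sum>i\<in>{p..<q}. w i)"
      proof (cases "q - p \<le> 2 * T")
        case True
        then show ?thesis using short[OF q(1,2) less.prems(2) q(3)] sum_nonneg[of "{p..<q}" w] w0 by force
      next
        case False
        \<comment> \<open>The gap is longer than \<open>2 * T\<close>. If
          \<open>p + T \<le> i\<close>, the \<open>T\<close> positions ending at \<open>i\<close>
          lie strictly inside it; otherwise \<open>i + T < p + 2 * T < q\<close>, so the
          \<open>T\<close> positions following \<open>i\<close> do.\<close>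
        have "h \<le> w i" if i: "i \<in> {p..<q}" for i
        proof (cases "p + T \<le> i")
          case True
          then show ?thesis using i by (intro w_left allI impI no) auto
        next
          case False
          then show ?thesis using i \<open>\<not> q - p \<le> 2 * T\<close> by (intro w_right allI impI no) auto
        qed
        then have "h * (real q - real p) \<le> (\<Sum>i\<in>{p..<q}. w i)"
          using q by (intro const) auto
        then show ?thesis using loop[OF q(1,2) less.prems(2) q(3)] by linarith
      qed
      moreover have "ln (card (B q n)) \<le> (\<Sum>i\<in>{q..<n}. w i)"
        using q less.prems by (intro less.hyps) auto
      ultimately show ?thesis using split[of p q n] join[of p q n] q by linarith
    qed
  qed
  have "ln (card (B 0 n)) \<le> (\<Sum>i\<in>{0..<n}. w i)"
  proof (cases "\<exists>q<n. x q = a")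
    case False
    then have "k * (real n - real 0) \<le> (\<Sum>i\<in>{0..<n}. w i)"
      by (intro const w_before) auto
    then show ?thesis using trivial[of 0 n] by simp
  next
    case True
    define q where "q = (LEAST q. q < n \<and> x q = a)"
    have q: "q < n" "x q = a" using LeastI_ex[OF True] by (simp_all add: q_def)
    have no: "x j \<noteq> a" if "j < q" for j
      using that not_less_Least[of j "\<lambda>q. q < n \<and> x q = a"] q(1) by (auto simp: q_def)
    have "k * (real q - real 0) \<le> (\<Sum>i\<in>{0..<q}. w i)"
      using no by (intro const w_before) auto
    then show ?thesis
      using trivial[of 0 q] from_visit[OF q] split[of 0 q n] join[of 0 q n] q by simp
  qed
  then show "ln (card A) \<le> (\<Sum>i<n. ambiguity a T h (ln (Suc (card G))) n x i)"
    by (simp add: A w_def k_def atLeast0LessThan)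
  show "finite A" by (simp add: A fin)
qed

section \<open>The entropy inequality for recurrent measures\<close>

text \<open>Meant for the two ends of an orbit segment: the probability of no visit among
  \<open>i\<close> positions tends to 0 but need not be summable, so only its average is
  negligible.\<close>

lemma cesaro_zero:
  fixes r :: "nat \<Rightarrow> real"
  assumes r: "r \<longlonglongrightarrow> 0" and r01: "\<And>n. 0 \<le> r n" "\<And>n. r n \<le> 1"
  shows "(\<lambda>n. (\<Sum>i<n. r i) / n) \<longlonglongrightarrow> 0"
proof (rule LIMSEQ_I)
  fix e :: real assume e: "0 < e"
  then obtain J where J: "\<And>n. J \<le> n \<Longrightarrow> r n < e / 2"
    using LIMSEQ_D[OF r, of "e / 2"] r01 by (auto simp: abs_of_nonneg)
  obtain K :: nat where K: "2 * J / e < K" using reals_Archimedean2 by blast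
  show "\<exists>no. \<forall>n\<ge>no. norm ((\<Sum>i<n. r i) / n - 0) < e"
  proof (intro exI allI impI)
    fix n assume n: "Suc (max J K) \<le> n"
    have "(\<Sum>i<n. r i) = (\<Sum>i<J. r i) + (\<Sum>i=J..<n. r i)"
      using n by (simp add: lessThan_atLeast0 sum.atLeastLessThan_concat)
    also have "\<dots> \<le> (\<Sum>i<J. 1) + (\<Sum>i=J..<n. e / 2)"
      using r01 J by (intro add_mono sum_mono) (auto intro: less_imp_le)
    also have "\<dots> \<le> J + e / 2 * n" using e n by (simp add: of_nat_diff algebra_simps)
    also have "\<dots> < e / 2 * n + e / 2 * n"
    proof -
      have "2 * J / e < n" using K n by linarith
      then show ?thesis using e by (simp add: field_simps)
    qed
    finally have "(\<Sum>i<n. r i) / n < e" using n by (simp add: field_simps)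
    moreover have "0 \<le> (\<Sum>i<n. r i) / n" using r01 by (simp add: sum_nonneg)
    ultimately show "norm ((\<Sum>i<n. r i) / n - 0) < e" by simp
  qed
qed

definition avoiding :: "('a \<Rightarrow> 'a \<Rightarrow> nat) \<Rightarrow> 'a \<Rightarrow> nat \<Rightarrow> (nat \<Rightarrow> 'a) set" where
  "avoiding S a n = {x \<in> markov_shift_space S. \<forall>i<n. x i \<noteq> a}"

lemma sets_avoiding: "avoiding S a n \<in> sets (markov_shift_borel S)"
  by (rule sets_markov_shift_prefix[of _ _ n]) (auto simp: avoiding_def)

text \<open>The kernel guesses the \<open>G\<close>-itinerary uniformly among those compatible with
  the observed \<open>F\<close>-itinerary, which costs the logarithm of their number. Recurrence
  makes the end pieces negligible; with them \<open>G\<close> drops out and only the window terms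
  remain.\<close>

lemma entropy_rate_letter_code_le:
  fixes S :: "'a :: countable \<Rightarrow> 'a \<Rightarrow> nat" and M :: "(nat \<Rightarrow> 'a) measure"
  assumes inv: "invariant_prob_measure shift_map M" and sets: "sets M = sets (markov_shift_borel S)"
    and recurrent: "(\<lambda>n. measure M (avoiding S a n)) \<longlonglongrightarrow> 0"
    and G: "finite G" and F: "finite F" "a \<in> F" "\<And>l. l \<le> 2 * T \<Longrightarrow> \<Union> (set ` loops S a l) \<subseteq> F"
    and h: "0 \<le> h" and loops: "\<And>l. 0 < l \<Longrightarrow> finite (loops S a l) \<and> card (loops S a l) \<le> exp (h * l)"
  shows "entropy_rate shift_map M (letter_code G)
    \<le> entropy_rate shift_map M (letter_code F) + 2 * h * measure M (avoiding S a T)"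
proof -
  interpret prob_space M using inv by (simp add: invariant_prob_measure_def)
  have T: "shift_map \<in> M \<rightarrow>\<^sub>M M" using inv by (simp add: invariant_prob_measure_def)
  have sp: "space M = markov_shift_space S" using sets_eq_imp_space_eq[OF sets] by simp
  have simple: "simple_function M (letter_code G)" if "finite G" for G
    using simple_function_letter_code[OF that, of S] sets sp by (simp add: simple_function_def)
  define r where "r n = prob (avoiding S a n)" for n
  define k where "k = ln (Suc (card G))"
  have k: "0 \<le> k" by (simp add: k_def)
  have ev: "avoiding S a n \<in> events" for n using sets_avoiding sets by simp
  have r01: "0 \<le> r n" "r n \<le> 1" for n by (simp_all add: r_def)
  have r_mono: "r n \<le> r m" if "m \<le> n" for m n
    unfolding r_def
    by (rule finite_measure_mono[OF _ ev]) (use that in \<open>auto simp: avoiding_def dest: less_le_trans\<close>)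
  \<comment> \<open>By invariance the probability of avoiding \<open>a\<close> along a window
    depends only on its length. Every term of \<open>ambiguity\<close> is the indicator of such a
    window event, up to the guard \<open>T \<le> i\<close>.\<close>
  have win: "integrable M (\<lambda>x. of_bool (\<forall>j<m. x (i + j) \<noteq> a) :: real)"
    "(\<integral>x. of_bool (\<forall>j<m. x (i + j) \<noteq> a) \<partial>M) = r m" for i m
  proof -
    let ?E = "(shift_map ^^ i) -` avoiding S a m \<inter> space M"
    have E: "?E \<in> events"
      using ev invariant_prob_measure_funpow(1)[OF inv] by (rule measurable_sets[rotated])
    have eq: "of_bool (\<forall>j<m. x (i + j) \<noteq> a) = indicat_real ?E x" if "x \<in> space M" for x
      using that funpow_shift_map_markov_shift_space[of x S i]
      by (auto simp: avoiding_def funpow_shift_map sp add.commute)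
    have "integrable M (indicat_real ?E)" using E by (simp add: less_top[symmetric])
    then show "integrable M (\<lambda>x. of_bool (\<forall>j<m. x (i + j) \<noteq> a) :: real)"
      by (rule Bochner_Integration.integrable_cong[THEN iffD1, rotated -1]) (simp_all add: eq)
    have "(\<integral>x. of_bool (\<forall>j<m. x (i + j) \<noteq> a) \<partial>M) = (\<integral>x. indicat_real ?E x \<partial>M)"
      by (rule Bochner_Integration.integral_cong) (simp_all add: eq)
    also have "\<dots> = prob ?E" using E by simp
    also have "\<dots> = r m" unfolding r_def by (rule measure_invariant[OF inv ev])
    finally show "(\<integral>x. of_bool (\<forall>j<m. x (i + j) \<noteq> a) \<partial>M) = r m" .
  qed
  have amb: "integrable M (\<lambda>x. ambiguity a T h k n x i)"
    "(\<integral>x. ambiguity a T h k n x i \<partial>M) \<le> k * (r i + r (n - Suc i)) + 2 * h * r T" if "i < n" for n i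
  proof -
    have 1: "(\<forall>j\<le>i. x j \<noteq> a) \<longleftrightarrow> (\<forall>j<Suc i. x (0 + j) \<noteq> a)" for x by (simp add: less_Suc_eq_le)
    have 2: "(\<forall>j. i < j \<and> j < n \<longrightarrow> x j \<noteq> a) \<longleftrightarrow> (\<forall>j<n - Suc i. x (Suc i + j) \<noteq> a)" for x
    proof (intro iffI allI impI)
      fix j assume "\<forall>j<n - Suc i. x (Suc i + j) \<noteq> a" "i < j \<and> j < n"
      then show "x j \<noteq> a" by (auto dest!: spec[of _ "j - Suc i"])
    qed auto
    have 3: "(\<forall>j. i - T < j \<and> j \<le> i \<longrightarrow> x j \<noteq> a) \<longleftrightarrow> (\<forall>j<T. x (Suc (i - T) + j) \<noteq> a)" if "T \<le> i" for x
    proof (intro iffI allI impI)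
      fix j assume "\<forall>j<T. x (Suc (i - T) + j) \<noteq> a" "i - T < j \<and> j \<le> i"
      then show "x j \<noteq> a" using that by (auto dest!: spec[of _ "j - Suc (i - T)"])
    next
      fix j assume "\<forall>j. i - T < j \<and> j \<le> i \<longrightarrow> x j \<noteq> a" "j < T"
      then show "x (Suc (i - T) + j) \<noteq> a" using that by (elim allE[of _ "Suc (i - T) + j"]) auto
    qed
    have 4: "(\<forall>j. i < j \<and> j \<le> i + T \<longrightarrow> x j \<noteq> a) \<longleftrightarrow> (\<forall>j<T. x (Suc i + j) \<noteq> a)" for x
    proof (intro iffI allI impI)
      fix j assume "\<forall>j<T. x (Suc i + j) \<noteq> a" "i < j \<and> j \<le> i + T"
      then show "x j \<noteq> a" by (auto dest!: spec[of _ "j - Suc i"])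
    qed auto
    \<comment> \<open>The full left window exists only for \<open>T \<le> i\<close>; earlier
      positions contribute 0, which is still at most \<open>r T\<close>.\<close>
    define L where "L x = (if T \<le> i then of_bool (\<forall>j<T. x (Suc (i - T) + j) \<noteq> a) else 0 :: real)" for x
    have L: "integrable M L" "(\<integral>x. L x \<partial>M) \<le> r T"
      unfolding L_def using win(1)[of T "Suc (i - T)"] win(2)[of T "Suc (i - T)"] r01(1)[of T]
      by (cases "T \<le> i"; simp)+
    have eq: "ambiguity a T h k n x i = k * (of_bool (\<forall>j<Suc i. x (0 + j) \<noteq> a)
        + of_bool (\<forall>j<n - Suc i. x (Suc i + j) \<noteq> a)) + h * (L x + of_bool (\<forall>j<T. x (Suc i + j) \<noteq> a))" for x
      unfolding ambiguity_def 1 2 4 L_def using 3 by (cases "T \<le> i") simp_all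
    note int = win(1)[of "Suc i" 0] win(1)[of "n - Suc i" "Suc i"] win(1)[of T "Suc i"]
    show "integrable M (\<lambda>x. ambiguity a T h k n x i)"
      unfolding eq using int L by (intro Bochner_Integration.integrable_add integrable_mult_right)
    have "(\<integral>x. ambiguity a T h k n x i \<partial>M) = k * (r (Suc i) + r (n - Suc i)) + h * ((\<integral>x. L x \<partial>M) + r T)"
      unfolding eq using int L(1)
      by (simp only: Bochner_Integration.integral_add integral_mult_right_zero win(2)
          Bochner_Integration.integrable_add integrable_mult_right)
    \<comment> \<open>\<open>r (Suc i)\<close> is relaxed to \<open>r i\<close>, so that both end
      terms add up over \<open>i < n\<close> to the same sum of the \<open>r i\<close>.\<close>
    also have "\<dots> \<le> k * (r i + r (n - Suc i)) + h * (r T + r T)"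
      using k h L r_mono[of i "Suc i"] by (intro add_mono mult_left_mono) auto
    finally show "(\<integral>x. ambiguity a T h k n x i \<partial>M) \<le> k * (r i + r (n - Suc i)) + 2 * h * r T" by simp
  qed
  define s where "s n = 2 * k * (\<Sum>i<n. r i)" for n
  let ?X = "itinerary shift_map (letter_code G)" and ?Y = "itinerary shift_map (letter_code F)"
  have "shannon_entropy M (?X n) \<le> shannon_entropy M (?Y (n + 0)) + (2 * h * r T * n + s n)" for n
  proof -
    define A where "A w = ?X n ` {y \<in> markov_shift_space S. ?Y n y = w}" for w
    define q where "q u w = (if u \<in> A w then 1 / card (A w) else 0)" for u w
    have A: "finite (A (?Y n x))" "ln (card (A (?Y n x))) \<le> (\<Sum>i<n. ambiguity a T h k n x i)"
      if "x \<in> space M" for x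
      using ln_card_compatible_codes_le[where T=T and n=n, OF that[unfolded sp] G h loops F(2,3)]
      by (simp_all add: A_def k_def)
    have mem: "?X n x \<in> A (?Y n x)" if "x \<in> space M" for x
      using that unfolding A_def sp by blast
    have card: "0 < card (A (?Y n x))" if "x \<in> space M" for x
      using A(1)[OF that] mem[OF that] by (auto simp: card_gt_0_iff)
    have "shannon_entropy M (?X n) \<le> shannon_entropy M (?Y n) + (\<integral>x. (\<Sum>i<n. ambiguity a T h k n x i) \<partial>M)"
    proof (rule shannon_entropy_gibbs[where q=q])
      show XY: "simple_function M (?X n)" "simple_function M (?Y n)"
        by (intro simple_function_itinerary simple G F T)+
      show "0 \<le> q u w" for u w by (simp add: q_def)
      show "(\<Sum>u\<in>?X n ` space M. q u w) \<le> 1" if "w \<in> ?Y n ` space M" for w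
      proof -
        obtain x where x: "x \<in> space M" "w = ?Y n x" using \<open>w \<in> ?Y n ` space M\<close> by blast
        have sub: "A w \<subseteq> ?X n ` space M" by (auto simp: A_def sp)
        have "(\<Sum>u\<in>?X n ` space M. q u w) = (\<Sum>u\<in>A w. q u w)"
          by (rule sum.mono_neutral_right) (use simple_functionD(1)[OF XY(1)] sub in \<open>auto simp: q_def\<close>)
        also have "\<dots> = (\<Sum>u\<in>A w. 1 / card (A w))" by (rule sum.cong) (auto simp: q_def)
        also have "\<dots> \<le> 1" by simp
        finally show ?thesis .
      qed
      show "0 < q u w" if "0 < prob {x \<in> space M. ?X n x = u \<and> ?Y n x = w}" for u w
      proof -
        have "{x \<in> space M. ?X n x = u \<and> ?Y n x = w} \<noteq> {}" using that by (metis less_irrefl measure_empty)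
        then obtain x where "x \<in> space M" "?X n x = u" "?Y n x = w" by blast
        then show ?thesis using mem[of x] card[of x] by (auto simp: q_def)
      qed
      show "- ln (q (?X n x) (?Y n x)) \<le> (\<Sum>i<n. ambiguity a T h k n x i)" if "x \<in> space M" for x
        using mem[OF that] card[OF that] A(2)[OF that] by (simp add: q_def ln_div)
      show "integrable M (\<lambda>x. \<Sum>i<n. ambiguity a T h k n x i)"
        by (intro Bochner_Integration.integrable_sum amb) simp
    qed
    also have "(\<integral>x. (\<Sum>i<n. ambiguity a T h k n x i) \<partial>M) = (\<Sum>i<n. \<integral>x. ambiguity a T h k n x i \<partial>M)"
      by (intro Bochner_Integration.integral_sum amb) simp
    also have "\<dots> \<le> (\<Sum>i<n. k * (r i + r (n - Suc i)) + 2 * h * r T)"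
      by (intro sum_mono amb) simp
    also have "\<dots> = 2 * h * r T * n + s n"
      using sum.nat_diff_reindex[of r n]
      by (simp add: s_def sum.distrib sum_distrib_left[symmetric] algebra_simps)
    finally show ?thesis by simp
  qed
  moreover have "(\<lambda>n. s n / n) \<longlonglongrightarrow> 0"
  proof -
    have "(\<lambda>n. 2 * k * ((\<Sum>i<n. r i) / n)) \<longlonglongrightarrow> 2 * k * 0"
      using recurrent r01 by (intro tendsto_mult tendsto_const cesaro_zero) (simp_all add: r_def)
    then show ?thesis by (simp add: s_def)
  qed
  ultimately show ?thesis
    unfolding r_def[of T, symmetric]
    by (rule entropy_rate_le_entropy_rate[OF inv simple[OF G] simple[OF F(1)]])
qed

section \<open>Ergodic measures from concatenated loops\<close>

text \<open>Averaging a \<open>T ^^ l\<close>-invariant measure over its first \<open>l\<close>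
  images under \<open>T\<close> gives a \<open>T\<close>-invariant one. A \<open>T\<close>-invariant
  set has the same measure under \<rho> and under the average, so the zero-one law passes
  over.\<close>

lemma ergodic_average:
  fixes \<rho> :: "'b measure"
  assumes \<rho>: "prob_space \<rho>" and T: "T \<in> \<rho> \<rightarrow>\<^sub>M \<rho>" and inv: "distr \<rho> \<rho> (T ^^ l) = \<rho>" and l: "0 < l"
    and zero_one: "\<And>A. A \<in> sets \<rho> \<Longrightarrow> T -` A \<inter> space \<rho> = A \<Longrightarrow> measure \<rho> A = 0 \<or> measure \<rho> A = 1"
  defines "\<nu> \<equiv> measure_pmf (pmf_of_set {..<l}) \<bind> (\<lambda>j. distr \<rho> \<rho> (T ^^ j))"
  shows "ergodic_prob_measure T \<nu>" and "sets \<nu> = sets \<rho>"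
    and "\<And>A. A \<in> sets \<rho> \<Longrightarrow> measure \<nu> A = (\<Sum>j<l. measure \<rho> ((T ^^ j) -` A \<inter> space \<rho>)) / l"
proof -
  interpret \<rho>: prob_space \<rho> by (rule \<rho>)
  have Tj: "T ^^ j \<in> \<rho> \<rightarrow>\<^sub>M \<rho>" for j using T by (rule measurable_compose_n)
  have D: "prob_space (distr \<rho> \<rho> (T ^^ j))" for j by (rule \<rho>.prob_space_distr[OF Tj])
  have meas: "(\<lambda>j. distr \<rho> \<rho> (T ^^ j)) \<in> measure_pmf (pmf_of_set {..<l}) \<rightarrow>\<^sub>M subprob_algebra \<rho>"
    using D by (auto simp: space_subprob_algebra intro: prob_space_imp_subprob_space)
  show sets: "sets \<nu> = sets \<rho>"
    unfolding \<nu>_def by (rule sets_bind) auto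
  have space: "space \<nu> = space \<rho>" by (rule sets_eq_imp_space_eq[OF sets])
  have \<nu>: "prob_space \<nu>"
    unfolding \<nu>_def by (rule measure_pmf.prob_space_bind[OF _ meas]) (simp add: D)
  interpret \<nu>: prob_space \<nu> by (rule \<nu>)
  show avg: "measure \<nu> A = (\<Sum>j<l. measure \<rho> ((T ^^ j) -` A \<inter> space \<rho>)) / l" if "A \<in> sets \<rho>" for A
  proof -
    have "measure \<nu> A = (\<integral>j. measure (distr \<rho> \<rho> (T ^^ j)) A \<partial>measure_pmf (pmf_of_set {..<l}))"
      unfolding \<nu>_def by (rule measure_pmf.measure_bind[OF meas that])
    also have "\<dots> = (\<Sum>j<l. measure (distr \<rho> \<rho> (T ^^ j)) A) / l"
      using l by (subst integral_pmf_of_set) auto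
    finally show ?thesis using that Tj by (simp add: measure_distr)
  qed
  have T\<nu>: "T \<in> \<nu> \<rightarrow>\<^sub>M \<nu>" using T by (simp add: measurable_cong_sets[OF sets sets])
  have "distr \<nu> \<nu> T = \<nu>"
  proof (rule measure_eqI)
    fix A assume "A \<in> sets (distr \<nu> \<nu> T)"
    then have A: "A \<in> sets \<rho>" by (simp add: sets)
    define f where "f j = measure \<rho> ((T ^^ j) -` A \<inter> space \<rho>)" for j
    have TA: "T -` A \<inter> space \<rho> \<in> sets \<rho>" using T A by (rule measurable_sets)
    have f_Suc: "measure \<rho> ((T ^^ j) -` (T -` A \<inter> space \<rho>) \<inter> space \<rho>) = f (Suc j)" for j
      unfolding f_def using measurable_space[OF Tj] by (intro arg_cong[of _ _ "measure \<rho>"]) auto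
    have "f l = measure (distr \<rho> \<rho> (T ^^ l)) A"
      using A Tj by (simp add: f_def measure_distr)
    then have fl: "f l = f 0"
      unfolding inv using sets.sets_into_space[OF A] by (simp add: f_def Int_absorb2)
    have "measure \<nu> (T -` A \<inter> space \<rho>) = (\<Sum>j<l. f (Suc j)) / l"
      by (simp only: avg[OF TA] f_Suc)
    \<comment> \<open>Pulling back by \<open>T\<close> moves the sum by one step, and
      \<open>f l = f 0\<close> closes the cycle.\<close>
    also have "(\<Sum>j<l. f (Suc j)) = (\<Sum>j<l. f j)"
      using sum.lessThan_Suc_shift[of f l] fl by simp
    also have "(\<Sum>j<l. f j) / l = measure \<nu> A"
      by (simp add: avg[OF A] f_def)
    finally have "measure \<nu> (T -` A \<inter> space \<rho>) = measure \<nu> A" .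
    then show "emeasure (distr \<nu> \<nu> T) A = emeasure \<nu> A"
      using A T\<nu> by (simp add: emeasure_distr sets space \<nu>.emeasure_eq_measure)
  qed simp
  moreover have "measure \<nu> A = 0 \<or> measure \<nu> A = 1" if "A \<in> sets \<nu>" "T -` A \<inter> space \<nu> = A" for A
  proof -
    have A: "A \<in> sets \<rho>" "T -` A \<inter> space \<rho> = A" using that by (simp_all add: sets space)
    have "(T ^^ j) -` A \<inter> space \<rho> = A" for j
    proof (induction j)
      case 0
      then show ?case using sets.sets_into_space[OF A(1)] by auto
    next
      case (Suc j)
      have "(T ^^ Suc j) -` A \<inter> space \<rho> = (T ^^ j) -` (T -` A \<inter> space \<rho>) \<inter> space \<rho>"
        using measurable_space[OF Tj] by auto
      then show ?case using Suc A(2) by (simp add: comp_def)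
    qed
    then have "measure \<nu> A = measure \<rho> A" using l by (simp add: avg[OF A(1)])
    then show ?thesis using zero_one[OF A] by simp
  qed
  ultimately show "ergodic_prob_measure T \<nu>"
    using \<nu> T\<nu> by (simp add: ergodic_prob_measure_def invariant_prob_measure_def)
qed

section \<open>Independent sequences and their factors\<close>

lemma shift_PiM_invariant:
  fixes K :: "'b measure"
  assumes K: "prob_space K"
  defines "P \<equiv> PiM UNIV (\<lambda>_ :: nat. K)"
  shows "(\<lambda>y n. y (n + m)) \<in> P \<rightarrow>\<^sub>M P" and "distr P P (\<lambda>y n. y (n + m)) = P"
proof -
  show "(\<lambda>y n. y (n + m)) \<in> P \<rightarrow>\<^sub>M P"
    unfolding P_def by (rule measurable_PiM_single') (auto simp: space_PiM)
  have "distr P P (\<lambda>y. \<lambda>n\<in>UNIV. y (n + m)) = P"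
    unfolding P_def by (rule distr_PiM_reindex[where f="\<lambda>n. n + m" and K=UNIV and M="\<lambda>_. K"]) (auto simp: K)
  then show "distr P P (\<lambda>y n. y (n + m)) = P" by (simp add: restrict_def)
qed

text \<open>A shift-invariant set equals its preimage under the \<open>n\<close>-th power of the
  shift, and that preimage depends only on coordinates from \<open>n\<close> on. So the set is a
  tail event and Kolmogorov's law applies.\<close>

lemma shift_PiM_zero_one:
  fixes K :: "'b measure"
  assumes K: "prob_space K"
  defines "P \<equiv> PiM UNIV (\<lambda>_ :: nat. K)"
  assumes E: "E \<in> sets P" and inv: "\<And>y. y \<in> space P \<Longrightarrow> (\<lambda>n. y (Suc n)) \<in> E \<longleftrightarrow> y \<in> E"
  shows "measure P E = 0 \<or> measure P E = 1"
proof -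
  interpret P: prob_space P unfolding P_def by (rule prob_space_PiM) (rule K)
  define C where "C i = {(\<lambda>y. y i) -` A \<inter> space P | A. A \<in> sets K}" for i :: nat
  have comp: "(\<lambda>y. y i) \<in> P \<rightarrow>\<^sub>M K" for i :: nat
    unfolding P_def by (rule measurable_component_singleton) simp
  have spE: "E \<subseteq> space P" by (rule sets.sets_into_space[OF E])
  show ?thesis
  proof (rule P.kolmogorov_0_1_law[of C])
    show "sigma_algebra (space P) (C i)" for i
    proof -
      have "C i = sets (vimage_algebra (space P) (\<lambda>y. y i) K)"
        unfolding C_def by (rule sets_vimage_algebra2[symmetric]) (use measurable_space[OF comp] in auto)
      then show ?thesis
        using sets.sigma_algebra_axioms[of "vimage_algebra (space P) (\<lambda>y. y i) K"] by simp
    qed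
    have "P.indep_vars (\<lambda>_. K) (\<lambda>i y. y i) (UNIV :: nat set)"
    proof (subst P.indep_vars_iff_distr_eq_PiM')
      have "distr P (PiM UNIV (\<lambda>_. K)) (\<lambda>y. \<lambda>i\<in>UNIV. y i) = distr P P (\<lambda>y n. y (n + 0))"
        by (simp add: P_def restrict_def)
      also have "\<dots> = P" using shift_PiM_invariant(2)[OF K, of 0] by (simp add: P_def)
      also have "P = PiM UNIV (\<lambda>i. distr P K (\<lambda>y. y i))"
        unfolding P_def by (subst distr_PiM_component) (auto simp: K)
      finally show "distr P (PiM UNIV (\<lambda>_. K)) (\<lambda>y. \<lambda>i\<in>UNIV. y i) = PiM UNIV (\<lambda>i. distr P K (\<lambda>y. y i))" .
    qed (use comp in auto)
    then show "P.indep_sets C UNIV"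
      unfolding P.indep_vars_def2 C_def by simp
    show "E \<in> P.tail_events C"
      unfolding P.tail_events_def
    proof
      fix n
      define N where "N = sigma (space P) (\<Union> (C ` {n..}))"
      have sub: "\<Union> (C ` {n..}) \<subseteq> Pow (space P)" by (auto simp: C_def)
      have N: "space N = space P" "sets N = sigma_sets (space P) (\<Union> (C ` {n..}))"
        using sub by (simp_all add: N_def)
      have "(\<lambda>y. y (i + n)) \<in> N \<rightarrow>\<^sub>M K" for i
      proof (rule measurableI)
        show "y (i + n) \<in> space K" if "y \<in> space N" for y
          using measurable_space[OF comp] that N by simp
        fix A assume "A \<in> sets K"
        then have "(\<lambda>y. y (i + n)) -` A \<inter> space P \<in> C (i + n)" by (auto simp: C_def)
        then show "(\<lambda>y. y (i + n)) -` A \<inter> space N \<in> sets N"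
          unfolding N by (intro sigma_sets.Basic) auto
      qed
      then have "(\<lambda>y i. y (i + n)) \<in> N \<rightarrow>\<^sub>M P"
        unfolding P_def by (rule measurable_PiM_single') (use N in \<open>auto simp: P_def space_PiM\<close>)
      then have "(\<lambda>y i. y (i + n)) -` E \<inter> space N \<in> sets N"
        using E by (rule measurable_sets)
      moreover have "(\<lambda>i. y (i + n)) \<in> E \<longleftrightarrow> y \<in> E" if "y \<in> space P" for y
        using that
      proof (induction n arbitrary: y)
        case (Suc n)
        have "(\<lambda>i. y (Suc i)) \<in> space P"
          using Suc.prems by (auto simp: P_def space_PiM)
        from Suc.IH[OF this] inv[OF Suc.prems] show ?case by simp
      qed simp
      then have "(\<lambda>y i. y (i + n)) -` E \<inter> space N = E" using spE N by auto
      ultimately show "E \<in> sigma_sets (space P) (\<Union> (C ` {n..}))" using N by simp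
    qed
  qed
qed

text \<open>Under \<pi> the shift corresponds to \<open>T ^^ l\<close>, so the image of the product
  measure is \<open>T ^^ l\<close>-invariant, and a \<open>T\<close>-invariant set pulls back to a
  shift-invariant one, which is trivial.\<close>

lemma ergodic_average_factor:
  fixes K :: "'b measure" and N :: "'c measure"
  assumes K: "prob_space K"
  defines "P \<equiv> PiM UNIV (\<lambda>_ :: nat. K)"
  assumes \<pi>: "\<pi> \<in> P \<rightarrow>\<^sub>M N" and T: "T \<in> N \<rightarrow>\<^sub>M N" and l: "0 < l"
    and factor: "\<And>y. y \<in> space P \<Longrightarrow> (T ^^ l) (\<pi> y) = \<pi> (\<lambda>n. y (Suc n))"
  obtains \<nu> where "ergodic_prob_measure T \<nu>" "sets \<nu> = sets N"
    "\<And>A. A \<in> sets N \<Longrightarrow> measure \<nu> A = (\<Sum>j<l. measure P {y \<in> space P. (T ^^ j) (\<pi> y) \<in> A}) / l"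
proof -
  interpret P: prob_space P unfolding P_def by (rule prob_space_PiM) (rule K)
  define \<rho> where "\<rho> = distr P N \<pi>"
  have \<rho>: "prob_space \<rho>" unfolding \<rho>_def by (rule P.prob_space_distr[OF \<pi>])
  have T\<rho>: "T \<in> \<rho> \<rightarrow>\<^sub>M \<rho>" using T by (simp add: \<rho>_def)
  have Tj: "T ^^ j \<in> N \<rightarrow>\<^sub>M N" for j using T by (rule measurable_compose_n)
  note shift = shift_PiM_invariant[OF K, of 1, folded P_def, simplified]
  have "distr \<rho> \<rho> (T ^^ l) = distr P N (T ^^ l \<circ> \<pi>)"
    unfolding \<rho>_def using Tj \<pi> by (subst distr_distr[symmetric]) (simp_all cong: distr_cong)
  also have "\<dots> = distr P N (\<pi> \<circ> (\<lambda>y n. y (Suc n)))"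
    by (rule distr_cong) (simp_all add: factor)
  also have "\<dots> = distr (distr P P (\<lambda>y n. y (Suc n))) N \<pi>"
    using \<pi> shift(1) by (rule distr_distr[symmetric])
  also have "\<dots> = \<rho>" by (simp add: shift(2) \<rho>_def)
  finally have inv: "distr \<rho> \<rho> (T ^^ l) = \<rho>" .
  have zo: "measure \<rho> A = 0 \<or> measure \<rho> A = 1" if A: "A \<in> sets \<rho>" "T -` A \<inter> space \<rho> = A" for A
  proof -
    have mem: "(T ^^ j) x \<in> A \<longleftrightarrow> x \<in> A" if "x \<in> space N" for x j
    proof (induction j)
      case (Suc j)
      have "(T ^^ j) x \<in> space N" using measurable_space[OF Tj that] .
      then have "T ((T ^^ j) x) \<in> A \<longleftrightarrow> (T ^^ j) x \<in> A" using A(2) by (auto simp: \<rho>_def)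
      then show ?case using Suc by simp
    qed simp
    let ?E = "\<pi> -` A \<inter> space P"
    have "measure P ?E = 0 \<or> measure P ?E = 1"
      unfolding P_def
    proof (rule shift_PiM_zero_one[OF K], fold P_def)
      show "?E \<in> sets P" using \<pi> A(1) by (auto simp: \<rho>_def)
      fix y assume y: "y \<in> space P"
      then have "(\<lambda>n. y (Suc n)) \<in> space P" using measurable_space[OF shift(1)] by simp
      moreover have "\<pi> (\<lambda>n. y (Suc n)) \<in> A \<longleftrightarrow> \<pi> y \<in> A"
        using mem[OF measurable_space[OF \<pi> y], of l] factor[OF y] by simp
      ultimately show "(\<lambda>n. y (Suc n)) \<in> ?E \<longleftrightarrow> y \<in> ?E" using y by simp
    qed
    moreover have "measure \<rho> A = measure P ?E"
      using A(1) \<pi> by (simp add: \<rho>_def measure_distr)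
    ultimately show ?thesis by simp
  qed
  note avg = ergodic_average[OF \<rho> T\<rho> inv l zo]
  have "measure \<rho> ((T ^^ j) -` A \<inter> space \<rho>) = measure P {y \<in> space P. (T ^^ j) (\<pi> y) \<in> A}"
    if A: "A \<in> sets N" for A j
  proof -
    have "(T ^^ j) -` A \<inter> space N \<in> sets N" using Tj A by (rule measurable_sets)
    then have "measure \<rho> ((T ^^ j) -` A \<inter> space \<rho>) = measure P (\<pi> -` ((T ^^ j) -` A \<inter> space N) \<inter> space P)"
      using \<pi> by (simp add: \<rho>_def measure_distr)
    also have "\<pi> -` ((T ^^ j) -` A \<inter> space N) \<inter> space P = {y \<in> space P. (T ^^ j) (\<pi> y) \<in> A}"
      using measurable_space[OF \<pi>] by auto
    finally show ?thesis .
  qed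
  then show thesis
    using that[OF avg(1)] avg(2,3) by (simp add: \<rho>_def)
qed

section \<open>Entropy of freely concatenated loops\<close>

definition concatenation :: "nat \<Rightarrow> (nat \<Rightarrow> 'a list) \<Rightarrow> nat \<Rightarrow> 'a" where
  "concatenation l y i = y (i div l) ! (i mod l)"

lemma length_loops: "u \<in> loops S a l \<Longrightarrow> length u = l"
  by (auto simp: loops_def)

lemma concatenation_nth: "m < l \<Longrightarrow> concatenation l y (t * l + m) = y t ! m"
  by (simp add: concatenation_def)

lemma concatenation_in_markov_shift_space:
  assumes l: "0 < l" and y: "\<And>n. y n \<in> loops S a l"
  shows "concatenation l y \<in> markov_shift_space S"
  unfolding markov_shift_space_def
proof (intro CollectI allI)
  fix i
  define d m where "d = i div l" and "m = i mod l"
  have m: "m < l" and i: "i = d * l + m" using l by (simp_all add: d_def m_def)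
  have "\<exists>x. y n = map x [0..<l] \<and> x \<in> markov_shift_space S \<and> x 0 = a \<and> x l = a" for n
    using y[of n] by (auto simp: loops_def)
  then obtain x where x: "\<And>n. y n = map (x n) [0..<l]" "\<And>n. x n \<in> markov_shift_space S"
    "\<And>n. x n 0 = a" "\<And>n. x n l = a" by metis
  have "concatenation l y i = x d m"
    using m by (simp add: i concatenation_nth x(1))
  moreover have "concatenation l y (Suc i) = x d (Suc m)"
  proof (cases "Suc m < l")
    case True
    then show ?thesis using concatenation_nth[OF True, of y d] by (simp add: i x(1))
  next
    case False
    \<comment> \<open>At the seam the next letter is the initial \<open>a\<close> of the following
      block. It is also the letter \<open>x d l\<close>, so the transition is one made by the
      admissible sequence \<open>x d\<close>.\<close>
    then have "Suc m = l" using m by simp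
    then have "Suc i = Suc d * l + 0" by (simp add: i)
    then have "concatenation l y (Suc i) = x (Suc d) 0"
      using l by (simp only: concatenation_nth x(1)) simp
    then show ?thesis using x(3)[of "Suc d"] x(4)[of d] \<open>Suc m = l\<close> by simp
  qed
  ultimately show "S (concatenation l y i) (concatenation l y (Suc i)) = 1"
    using x(2)[of d] by (simp add: markov_shift_space_def)
qed

lemma shift_concatenation:
  assumes "0 < l"
  shows "(shift_map ^^ l) (concatenation l y) = concatenation l (\<lambda>n. y (Suc n))"
  using assms by (auto simp: funpow_shift_map concatenation_def)

text \<open>The measure is the average over phases of independent uniform choices from
  \<open>W\<close>. A word of length \<open>n\<close> fixes nearly \<open>n / l\<close> whole blocks
  whatever the phase, so all fibres are exponentially small, and a uniform upper bound on atoms is a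
  lower bound on entropy.\<close>

lemma exists_ergodic_measure_of_loops:
  fixes S :: "'a :: countable \<Rightarrow> 'a \<Rightarrow> nat"
  assumes l: "0 < l" and W: "finite W" "W \<noteq> {}" "W \<subseteq> loops S a l"
  obtains \<nu> where "\<nu> \<in> ergodic_measures S" "ereal (ln (card W) / l) \<le> ks_entropy shift_map \<nu>"
proof -
  define K where "K = uniform_count_measure W"
  define P where "P = PiM UNIV (\<lambda>_ :: nat. K)"
  define B where "B = markov_shift_borel S"
  define \<pi> where "\<pi> = (concatenation l :: (nat \<Rightarrow> 'a list) \<Rightarrow> _)"
  have K: "prob_space K" unfolding K_def by (rule prob_space_uniform_count_measure) (use W in auto)
  interpret K: prob_space K by (rule K)
  interpret P: product_prob_space "\<lambda>_. K" UNIV by unfold_locales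
  have P: "prob_space P" unfolding P_def by (rule P.prob_space_axioms)
  interpret PP: prob_space P by (rule P)
  have yW: "y n \<in> W" if "y \<in> space P" for y n
    using that by (auto simp: P_def space_PiM K_def space_uniform_count_measure)
  have comp: "(\<lambda>y. y n) \<in> P \<rightarrow>\<^sub>M K" for n
    unfolding P_def by (rule measurable_component_singleton) simp
  have \<pi>_space: "\<pi> y \<in> markov_shift_space S" if "y \<in> space P" for y
    unfolding \<pi>_def using yW[OF that] W(3) by (intro concatenation_in_markov_shift_space[OF l, of y S a]) auto
  have \<pi>: "\<pi> \<in> P \<rightarrow>\<^sub>M B"
    unfolding B_def
  proof (rule measurable_markov_shift_borel)
    fix i
    have "(\<lambda>u. u ! (i mod l)) \<in> K \<rightarrow>\<^sub>M count_space UNIV"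
      by (rule measurableI) (auto simp: K_def sets_uniform_count_measure space_uniform_count_measure)
    from measurable_compose[OF comp this]
    show "(\<lambda>y. \<pi> y i) \<in> P \<rightarrow>\<^sub>M count_space UNIV"
      by (simp add: \<pi>_def concatenation_def)
  qed (use \<pi>_space in auto)
  have T: "shift_map \<in> B \<rightarrow>\<^sub>M B" unfolding B_def by (rule measurable_shift_map)
  have factor: "(shift_map ^^ l) (\<pi> y) = \<pi> (\<lambda>n. y (Suc n))" for y
    unfolding \<pi>_def by (rule shift_concatenation[OF l])
  obtain \<nu> where erg: "ergodic_prob_measure shift_map \<nu>" and sets: "sets \<nu> = sets B"
    and avg: "\<And>A. A \<in> sets B \<Longrightarrow> measure \<nu> A = (\<Sum>j<l. measure P {y \<in> space P. (shift_map ^^ j) (\<pi> y) \<in> A}) / l"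
  proof (rule ergodic_average_factor[OF K \<pi>[unfolded P_def] T l factor, folded P_def])
    fix \<nu> assume "ergodic_prob_measure shift_map \<nu>" "sets \<nu> = sets B"
      "\<And>A. A \<in> sets B \<Longrightarrow> measure \<nu> A = (\<Sum>j<l. measure P {y \<in> space P. (shift_map ^^ j) (\<pi> y) \<in> A}) / l"
    then show thesis by (rule that)
  qed
  have mem: "\<nu> \<in> ergodic_measures S"
    using erg sets by (simp add: ergodic_measures_def B_def)
  have inv: "invariant_prob_measure shift_map \<nu>" using erg by (simp add: ergodic_prob_measure_def)
  interpret \<nu>: prob_space \<nu> using inv by (simp add: invariant_prob_measure_def)
  have T\<nu>: "shift_map \<in> \<nu> \<rightarrow>\<^sub>M \<nu>" using inv by (simp add: invariant_prob_measure_def)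
  have space: "space \<nu> = markov_shift_space S"
    using sets_eq_imp_space_eq[OF sets] by (simp add: B_def)
  define F where "F = \<Union> (set ` W)"
  have F: "finite F" using W(1) by (simp add: F_def)
  let ?X = "letter_code F"
  have X: "simple_function \<nu> ?X"
    using simple_function_letter_code[OF F, of S] sets space by (simp add: simple_function_def B_def)
  have card_W: "0 < card W" using W by (simp add: card_gt_0_iff)
  have \<pi>F: "\<pi> y i \<in> F" if "y \<in> space P" for y i
    using yW[OF that, of "i div l"] W(3) l length_loops[of "y (i div l)" S a l]
    by (auto simp: \<pi>_def concatenation_def F_def intro!: bexI[of _ "y (i div l)"])
  have atom: "\<nu>.prob (itinerary shift_map ?X n -` {u} \<inter> space \<nu>) \<le> (1 / card W) ^ (n div l - 1)" for n u
  proof -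
    \<comment> \<open>Block 0 may be cut by the phase \<open>j < l\<close>; the blocks 1 to
      \<open>n div l - 1\<close> lie, for every such \<open>j\<close>, within the \<open>n\<close>
      positions read from \<open>j\<close> on.\<close>
    define J where "J = {1..n div l - 1}"
    let ?A = "itinerary shift_map ?X n -` {u} \<inter> space \<nu>"
    have A: "?A \<in> sets B"
      using simple_functionD(2)[OF simple_function_itinerary[OF X T\<nu>]] sets by simp
    have "PP.prob {y \<in> space P. (shift_map ^^ j) (\<pi> y) \<in> ?A} \<le> (1 / card W) ^ (n div l - 1)" if j: "j < l" for j
    proof (cases "{y \<in> space P. (shift_map ^^ j) (\<pi> y) \<in> ?A} = {}")
      case True
      then show ?thesis by (metis measure_empty zero_le_power zero_le_divide_1_iff of_nat_0_le_iff)
    next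
      case False
      then obtain z where z: "z \<in> space P" "(shift_map ^^ j) (\<pi> z) \<in> ?A" by blast
      have "{y \<in> space P. (shift_map ^^ j) (\<pi> y) \<in> ?A} \<subseteq> {y \<in> space P. \<forall>t\<in>J. y t \<in> {z t}}"
      proof (intro subsetI CollectI conjI ballI)
        fix y t assume "y \<in> {y \<in> space P. (shift_map ^^ j) (\<pi> y) \<in> ?A}" and t: "t \<in> J"
        then have y: "y \<in> space P" "(shift_map ^^ j) (\<pi> y) \<in> ?A" by simp_all
        have "itinerary shift_map ?X n ((shift_map ^^ j) (\<pi> y)) = itinerary shift_map ?X n ((shift_map ^^ j) (\<pi> z))"
          using y(2) z(2) by simp
        \<comment> \<open>All letters of \<open>\<pi> y\<close> lie in \<open>F\<close>, so equal
          codes mean equal letters.\<close>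
        then have eq: "\<pi> y (i + j) = \<pi> z (i + j)" if "i < n" for i
          using that \<pi>F[OF y(1)] unfolding itinerary_letter_code_eq_iff funpow_shift_map by blast
        have len: "length (y t) = l" "length (z t) = l"
          using subsetD[OF W(3) yW[OF y(1)]] subsetD[OF W(3) yW[OF z(1)]] by (auto dest: length_loops)
        have "y t = z t"
        proof (rule nth_equalityI)
          fix m assume "m < length (y t)"
          then have m: "m < l" using len by simp
          have t1: "1 \<le> t" "Suc t \<le> n div l" using t by (auto simp: J_def)
          have "l \<le> t * l" using t1(1) by (cases t) auto
          then have 1: "j \<le> t * l + m" using j by linarith
          have "t * l + m < Suc t * l" using m by simp
          also have "\<dots> \<le> n div l * l" using t1(2) by (rule mult_le_mono1)
          also have "\<dots> \<le> n" by simp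
          finally have "\<pi> y (t * l + m) = \<pi> z (t * l + m)"
            using eq[of "t * l + m - j"] 1 by simp
          then show "y t ! m = z t ! m" by (simp add: \<pi>_def concatenation_nth m)
        qed (simp add: len)
        then show "y t \<in> {z t}" by simp
      qed simp
      moreover have ev: "{y \<in> space P. \<forall>t\<in>J. y t \<in> {z t}} \<in> sets P"
      proof (rule sets.sets_Collect_finite_All)
        fix t
        have "(\<lambda>y. y t) -` {z t} \<inter> space P \<in> sets P"
          by (rule measurable_sets[OF comp]) (use yW[OF z(1)] in \<open>simp add: K_def sets_uniform_count_measure\<close>)
        then show "{y \<in> space P. y t \<in> {z t}} \<in> sets P" by (simp add: vimage_def Int_def conj_commute)
      qed (simp_all add: J_def)
      ultimately have "PP.prob {y \<in> space P. (shift_map ^^ j) (\<pi> y) \<in> ?A} \<le> PP.prob {y \<in> space P. \<forall>t\<in>J. y t \<in> {z t}}"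
        by (rule PP.finite_measure_mono)
      also have "\<dots> = (1 / card W) ^ (n div l - 1)"
      proof -
        have "emeasure P {y \<in> space P. \<forall>t\<in>J. y t \<in> {z t}} = (\<Prod>t\<in>J. emeasure K {z t})"
          unfolding P_def by (rule P.emeasure_PiM_Collect)
            (use yW[OF z(1)] in \<open>simp_all add: J_def K_def sets_uniform_count_measure\<close>)
        also have "\<dots> = (\<Prod>t\<in>J. ennreal (1 / card W))"
          using yW[OF z(1)] W(1) by (intro prod.cong) (simp_all add: K_def emeasure_uniform_count_measure)
        also have "\<dots> = ennreal ((1 / card W) ^ (n div l - 1))"
          by (simp add: J_def ennreal_power)
        finally show ?thesis by (simp add: measure_def)
      qed
      finally show ?thesis .
    qed
    then have "(\<Sum>j<l. PP.prob {y \<in> space P. (shift_map ^^ j) (\<pi> y) \<in> ?A}) \<le> (\<Sum>j<l. (1 / card W) ^ (n div l - 1))"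
      by (intro sum_mono) simp
    then show ?thesis using l by (simp add: avg[OF A] divide_le_eq mult.commute)
  qed
  define c where "c = ln (card W)"
  have c: "0 \<le> c" using card_W by (simp add: c_def)
  have "c / l - 2 * c / n \<le> shannon_entropy \<nu> (itinerary shift_map ?X n) / n" if n: "0 < n" for n
  proof -
    define N where "N = n div l - 1"
    have I: "simple_function \<nu> (itinerary shift_map ?X n)" by (rule simple_function_itinerary[OF X T\<nu>])
    let ?p = "\<lambda>u. \<nu>.prob (itinerary shift_map ?X n -` {u} \<inter> space \<nu>)"
    have le: "?p u * (c * N) \<le> - (?p u * ln (?p u))" for u
    proof (cases "?p u = 0")
      case False
      then have p: "0 < ?p u" by (simp add: zero_less_measure_iff)
      have "ln (?p u) \<le> ln ((1 / card W) ^ N)"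
        using p atom[of n u] card_W by (subst ln_le_cancel_iff) (simp_all add: N_def)
      also have "\<dots> = - (c * N)" using card_W by (simp add: ln_realpow c_def ln_div)
      finally have "?p u * (c * N) \<le> ?p u * (- ln (?p u))"
        using p by (intro mult_left_mono) simp_all
      then show ?thesis by simp
    qed simp
    have "c * N = (\<Sum>u\<in>itinerary shift_map ?X n ` space \<nu>. ?p u * (c * N))"
      using \<nu>.sum_prob_simple_function[OF I] by (simp add: sum_distrib_right[symmetric])
    also have "\<dots> \<le> shannon_entropy \<nu> (itinerary shift_map ?X n)"
      unfolding shannon_entropy_def sum_negf[symmetric] by (intro sum_mono le)
    finally have H: "c * N \<le> shannon_entropy \<nu> (itinerary shift_map ?X n)" .
    \<comment> \<open>One unit is lost to rounding and one to the discarded block 0.\<close>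
    have "real n / l - 2 \<le> N"
    proof -
      have "real n / l \<le> real (n div l) + 1"
      proof -
        have "n \<le> n div l * l + l"
          using div_mult_mod_eq[of n l] mod_less_divisor[OF l, of n] by linarith
        then have "real n \<le> real (n div l * l + l)" by (rule of_nat_mono)
        then show ?thesis using l by (simp add: divide_le_eq algebra_simps)
      qed
      then show ?thesis unfolding N_def by linarith
    qed
    then have "c * (real n / l - 2) / n \<le> c * N / n"
      using c by (intro divide_right_mono mult_left_mono) auto
    also have "\<dots> \<le> shannon_entropy \<nu> (itinerary shift_map ?X n) / n"
      using H by (rule divide_right_mono) simp
    finally show ?thesis using n l by (simp add: field_simps)
  qed
  then have ev: "\<exists>N. \<forall>n\<ge>N. c / l - 2 * c / n \<le> shannon_entropy \<nu> (itinerary shift_map ?X n) / n"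
    by (intro exI[of _ 1]) simp
  have "(\<lambda>n. c / l - 2 * c / n) \<longlonglongrightarrow> c / l - 0"
    by (intro tendsto_diff tendsto_const lim_const_over_n)
  from LIMSEQ_le[OF this entropy_rate(1)[OF inv X] ev] have "c / l \<le> entropy_rate shift_map \<nu> ?X" by simp
  then have "ereal (c / l) \<le> ks_entropy shift_map \<nu>"
    using entropy_rate_le_ks_entropy[OF X, of shift_map] order_trans ereal_less_eq(3) by blast
  then show thesis using that mem by (simp add: c_def)
qed

text \<open>The bound is proved for finite subsets first, since \<open>card\<close> of an infinite
  set is 0. An infinite set of loops would contain finite subsets of every size, so finiteness
  itself follows from the entropy bound.\<close>

lemma card_loops_le:
  fixes S :: "'a :: countable \<Rightarrow> 'a \<Rightarrow> nat"
  assumes h: "topological_entropy S \<le> ereal h" and l: "0 < l"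
  shows "finite (loops S a l)" and "card (loops S a l) \<le> exp (h * l)"
proof -
  have bound: "card W \<le> exp (h * l)" if W: "finite W" "W \<subseteq> loops S a l" for W
  proof (cases "W = {}")
    case False
    obtain \<nu> where "\<nu> \<in> ergodic_measures S" "ereal (ln (card W) / l) \<le> ks_entropy shift_map \<nu>"
      using exists_ergodic_measure_of_loops[OF l W(1) False W(2)] .
    then have "ereal (ln (card W) / l) \<le> topological_entropy S"
      unfolding topological_entropy_def by (meson SUP_upper order_trans)
    then have "ln (card W) / l \<le> h" using h order_trans ereal_less_eq(3) by blast
    then have "ln (card W) \<le> h * l" using l by (simp add: field_simps)
    moreover have "0 < card W" using W(1) False by (simp add: card_gt_0_iff)
    ultimately show ?thesis by (metis exp_le_cancel_iff exp_ln of_nat_0_less_iff)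
  qed simp
  show fin: "finite (loops S a l)"
  proof (rule ccontr)
    assume inf: "infinite (loops S a l)"
    obtain n :: nat where n: "exp (h * l) < n" using reals_Archimedean2 by blast
    obtain W where "W \<subseteq> loops S a l" "finite W" "card W = n"
      using infinite_arbitrarily_large[OF inf, of n] by blast
    with bound[of W] n show False by simp
  qed
  show "card (loops S a l) \<le> exp (h * l)" by (rule bound[OF fin order_refl])
qed

section \<open>Upper semi-continuity\<close>

text \<open>Infinitely many visits to \<open>a\<close> have positive probability, because each tail
  union has at least the measure of \<open>V 0\<close>; by ergodicity they are almost sure.\<close>

lemma avoiding_tendsto_zero:
  assumes \<nu>: "\<nu> \<in> ergodic_measures S" and a: "measure \<nu> {x \<in> markov_shift_space S. x 0 = a} > 0"
  shows "(\<lambda>n. measure \<nu> (avoiding S a n)) \<longlonglongrightarrow> 0"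
proof -
  have sets: "sets \<nu> = sets (markov_shift_borel S)" and erg: "ergodic_prob_measure shift_map \<nu>"
    using \<nu> by (simp_all add: ergodic_measures_def)
  have space: "space \<nu> = markov_shift_space S" using sets_eq_imp_space_eq[OF sets] by simp
  have inv: "invariant_prob_measure shift_map \<nu>" using erg by (simp add: ergodic_prob_measure_def)
  interpret prob_space \<nu> using inv by (simp add: invariant_prob_measure_def)
  define V where "V i = {x \<in> markov_shift_space S. x i = a}" for i
  have V: "V i \<in> events" for i
    unfolding sets V_def by (rule sets_markov_shift_prefix[of _ _ "Suc i"]) auto
  have pV: "prob (V i) = prob (V 0)" for i
  proof -
    have "(shift_map ^^ i) -` V 0 \<inter> space \<nu> = V i"
      using funpow_shift_map_markov_shift_space[of _ S i] by (auto simp: V_def space funpow_shift_map)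
    then show ?thesis using measure_invariant[OF inv V[of 0], of i] by simp
  qed
  define I where "I n = (\<Union>i\<in>{n..}. V i)" for n
  have I: "I n \<in> events" for n unfolding I_def using V by auto
  have "decseq I"
    unfolding decseq_def I_def by (intro allI impI UN_mono) auto
  then have lim: "(\<lambda>n. prob (I n)) \<longlonglongrightarrow> prob (\<Inter>n. I n)"
    using I by (intro finite_Lim_measure_decseq) auto
  have "prob (V 0) \<le> prob (I n)" for n
    unfolding pV[of n, symmetric] by (rule finite_measure_mono[OF _ I]) (auto simp: I_def)
  then have pI: "prob (V 0) \<le> prob (\<Inter>n. I n)" by (intro LIMSEQ_le_const[OF lim]) blast
  have mem: "x \<in> (\<Inter>n. I n) \<longleftrightarrow> x \<in> markov_shift_space S \<and> (\<forall>n. \<exists>i\<ge>n. x i = a)" for x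
    unfolding I_def V_def by blast
  \<comment> \<open>Ergodicity is stated for exactly invariant sets. The event of at least one visit
    satisfies only an inclusion, as a visit at time 0 may be the last one; infinitely many visits
    are unaffected by dropping a letter.\<close>
  have inv_I: "shift_map -` (\<Inter>n. I n) \<inter> space \<nu> = (\<Inter>n. I n)"
  proof (rule set_eqI)
    fix x
    have "(\<forall>n. \<exists>i\<ge>n. x (Suc i) = a) \<longleftrightarrow> (\<forall>n. \<exists>i\<ge>n. x i = a)"
    proof (intro iffI allI)
      fix n assume "\<forall>n. \<exists>i\<ge>n. x (Suc i) = a"
      then obtain i where "n \<le> i" "x (Suc i) = a" by blast
      then show "\<exists>i\<ge>n. x i = a" by (intro exI[of _ "Suc i"]) simp
    next
      fix n assume "\<forall>n. \<exists>i\<ge>n. x i = a"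
      then obtain i where "Suc n \<le> i" "x i = a" by blast
      then show "\<exists>i\<ge>n. x (Suc i) = a" by (cases i) auto
    qed
    then have "shift_map x \<in> (\<Inter>n. I n) \<longleftrightarrow> x \<in> (\<Inter>n. I n)" if "x \<in> markov_shift_space S"
      unfolding mem using that shift_map_markov_shift_space[OF that] by (simp add: shift_map_def)
    moreover have "x \<in> markov_shift_space S" if "x \<in> (\<Inter>n. I n)" using that unfolding mem by simp
    ultimately show "x \<in> shift_map -` (\<Inter>n. I n) \<inter> space \<nu> \<longleftrightarrow> x \<in> (\<Inter>n. I n)"
      unfolding space by blast
  qed
  have I_ev: "(\<Inter>n. I n) \<in> events" using I by auto
  have "prob (\<Inter>n. I n) = 0 \<or> prob (\<Inter>n. I n) = 1"
    using erg I_ev inv_I unfolding ergodic_prob_measure_def by blast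
  then have one: "prob (\<Inter>n. I n) = 1"
    using pI a by (auto simp: V_def)
  have ev: "avoiding S a n \<in> events" for n using sets_avoiding sets by simp
  have "decseq (avoiding S a)" by (auto simp: decseq_def avoiding_def dest: less_le_trans)
  then have "(\<lambda>n. prob (avoiding S a n)) \<longlonglongrightarrow> prob (\<Inter>n. avoiding S a n)"
    using ev by (intro finite_Lim_measure_decseq) auto
  moreover have "prob (\<Inter>n. avoiding S a n) \<le> prob (space \<nu> - (\<Inter>n. I n))"
  proof (rule finite_measure_mono)
    show "(\<Inter>n. avoiding S a n) \<subseteq> space \<nu> - (\<Inter>n. I n)"
    proof
      fix x assume x: "x \<in> (\<Inter>n. avoiding S a n)"
      have "x i \<noteq> a" for i
      proof -
        have "x \<in> avoiding S a (Suc i)" using x by blast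
        then show ?thesis by (simp add: avoiding_def)
      qed
      then have "x \<notin> (\<Inter>n. I n)" unfolding mem by blast
      then show "x \<in> space \<nu> - (\<Inter>n. I n)" using x by (auto simp: avoiding_def space)
    qed
  qed (use I_ev in blast)
  moreover have "prob (space \<nu> - (\<Inter>n. I n)) = 0"
    using one I_ev by (subst prob_compl) simp_all
  ultimately show ?thesis by (simp add: measure_le_0_iff)
qed

text \<open>Every finite partition is approximated by the code of some finite \<open>G\<close>, and
  the right-hand side is the same for all \<open>G\<close>. So one \<open>F\<close> controls the
  whole entropy, for all ergodic measures charging \<open>a\<close> at once.\<close>

lemma ks_entropy_le_letter_code:
  fixes S :: "'a :: countable \<Rightarrow> 'a \<Rightarrow> nat"
  assumes \<nu>: "\<nu> \<in> ergodic_measures S" and a: "measure \<nu> {x \<in> markov_shift_space S. x 0 = a} > 0"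
    and h: "topological_entropy S \<le> ereal h" "0 \<le> h"
    and F: "finite F" "a \<in> F" "\<And>l. l \<le> 2 * T \<Longrightarrow> \<Union> (set ` loops S a l) \<subseteq> F"
  shows "ks_entropy shift_map \<nu>
    \<le> ereal (entropy_rate shift_map \<nu> (letter_code F) + 2 * h * measure \<nu> (avoiding S a T))"
proof (rule ks_entropy_le)
  have sets: "sets \<nu> = sets (markov_shift_borel S)" and inv: "invariant_prob_measure shift_map \<nu>"
    using \<nu> by (simp_all add: ergodic_measures_def ergodic_prob_measure_def)
  fix X :: "(nat \<Rightarrow> 'a) \<Rightarrow> (nat \<Rightarrow> 'a) set" assume X: "simple_function \<nu> X"
  have "entropy_rate shift_map \<nu> X
      \<le> entropy_rate shift_map \<nu> (letter_code F) + 2 * h * measure \<nu> (avoiding S a T)"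
  proof (rule field_le_epsilon)
    fix d :: real assume "0 < d"
    then obtain G where G: "finite G"
      "entropy_rate shift_map \<nu> X \<le> entropy_rate shift_map \<nu> (letter_code G) + d"
      by (rule entropy_rate_le_letter_code[OF inv sets X])
    have "entropy_rate shift_map \<nu> (letter_code G)
        \<le> entropy_rate shift_map \<nu> (letter_code F) + 2 * h * measure \<nu> (avoiding S a T)"
      using card_loops_le[OF h(1)]
      by (intro entropy_rate_letter_code_le[OF inv sets avoiding_tendsto_zero[OF \<nu> a] G(1) F h(2)]) auto
    then show "entropy_rate shift_map \<nu> X
        \<le> entropy_rate shift_map \<nu> (letter_code F) + 2 * h * measure \<nu> (avoiding S a T) + d"
      using G(2) by simp
  qed
  then show "ereal (entropy_rate shift_map \<nu> X)
      \<le> ereal (entropy_rate shift_map \<nu> (letter_code F) + 2 * h * measure \<nu> (avoiding S a T))"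
    by simp
qed

section \<open>Weak continuity of finite entropies and the conclusion\<close>

text \<open>Only \<open>q = 0\<close> is delicate, where \<open>ln\<close> is unbounded. There
  \<open>x * ln x\<close> is at most \<open>2 * sqrt x\<close> in absolute value, by
  \<open>ln y \<le> y - 1\<close> at \<open>y = 1 / sqrt x\<close>.\<close>

lemma tendsto_mult_ln:
  fixes p :: "nat \<Rightarrow> real"
  assumes p: "p \<longlonglongrightarrow> q" and p01: "\<And>n. 0 \<le> p n" "\<And>n. p n \<le> 1"
  shows "(\<lambda>n. p n * ln (p n)) \<longlonglongrightarrow> q * ln q"
proof (cases "q = 0")
  case False
  then show ?thesis by (intro tendsto_mult tendsto_ln p)
next
  case True
  have bound: "\<bar>x * ln x\<bar> \<le> 2 * sqrt x" if x: "0 \<le> x" "x \<le> 1" for x :: real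
  proof (cases "x = 0")
    case False
    then have x0: "0 < x" using x by simp
    have "- ln x = 2 * ln (1 / sqrt x)" using x0 by (simp add: ln_div ln_sqrt)
    also have "\<dots> \<le> 2 * (1 / sqrt x)"
      using ln_le_minus_one[of "1 / sqrt x"] x0 by simp
    finally have "x * (- ln x) \<le> x * (2 * (1 / sqrt x))" using x0 by (intro mult_left_mono) simp_all
    also have "\<dots> = 2 * (x / sqrt x)" by simp
    also have "\<dots> = 2 * sqrt x" using x0 by (subst real_div_sqrt) simp_all
    finally have "x * (- ln x) \<le> 2 * sqrt x" .
    moreover have "x * ln x \<le> 0" using x x0 by (intro mult_nonneg_nonpos) simp_all
    ultimately show ?thesis by simp
  qed simp
  have "(\<lambda>n. 2 * sqrt (p n)) \<longlonglongrightarrow> 2 * sqrt 0"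
    using p True by (intro tendsto_intros) simp
  then have lim: "(\<lambda>n. 2 * sqrt (p n)) \<longlonglongrightarrow> 0" by simp
  have "(\<lambda>n. p n * ln (p n)) \<longlonglongrightarrow> 0"
  proof (rule Lim_null_comparison[OF always_eventually lim], rule allI)
    show "norm (p n * ln (p n)) \<le> 2 * sqrt (p n)" for n
      unfolding real_norm_def by (rule bound[OF p01])
  qed
  then show ?thesis using True by simp
qed

lemma shannon_entropy_tendsto:
  assumes lim: "weak_star_tendsto S \<mu>s \<mu>"
    and sets: "\<And>k. sets (\<mu>s k) = sets (markov_shift_borel S)" "sets \<mu> = sets (markov_shift_borel S)"
    and prob: "\<And>k. prob_space (\<mu>s k)"
    and X: "\<And>x y. x \<in> markov_shift_space S \<Longrightarrow> y \<in> markov_shift_space S \<Longrightarrow> \<forall>i<n. y i = x i \<Longrightarrow> X y = X x"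
  shows "(\<lambda>k. shannon_entropy (\<mu>s k) X) \<longlonglongrightarrow> shannon_entropy \<mu> X"
proof -
  have space: "space (\<mu>s k) = markov_shift_space S" "space \<mu> = markov_shift_space S" for k
    using sets_eq_imp_space_eq[OF sets(1)] sets_eq_imp_space_eq[OF sets(2)] by simp_all
  have "(\<lambda>k. measure (\<mu>s k) (X -` {v} \<inter> markov_shift_space S)) \<longlonglongrightarrow> measure \<mu> (X -` {v} \<inter> markov_shift_space S)" for v
  proof (rule weak_star_tendsto_prefix[OF lim sets, of _ n])
    fix x y assume x: "x \<in> X -` {v} \<inter> markov_shift_space S" and y: "y \<in> markov_shift_space S" "\<forall>i<n. y i = x i"
    have "X y = X x" using x y by (intro X) simp_all
    then show "y \<in> X -` {v} \<inter> markov_shift_space S" using x y by simp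
  qed simp
  then show ?thesis
    unfolding shannon_entropy_def space
    by (intro tendsto_minus tendsto_sum tendsto_mult_ln) (simp_all add: prob_space.prob_le_1[OF prob])
qed

theorem corollary1p2:
  fixes S :: "'a::countable \<Rightarrow> 'a \<Rightarrow> nat"
    and \<mu>s :: "nat \<Rightarrow> (nat \<Rightarrow> 'a) measure"
    and \<mu> :: "(nat \<Rightarrow> 'a) measure"
  assumes "\<And>i j. S i j \<in> {0, 1}"
    and "topological_entropy S < \<infinity>"
    and "\<And>n. \<mu>s n \<in> ergodic_measures S"
    and "\<mu> \<in> ergodic_measures S"
    and "weak_star_tendsto S \<mu>s \<mu>"
  shows "limsup (\<lambda>n. ks_entropy shift_map (\<mu>s n)) \<le> ks_entropy shift_map \<mu>"
proof (rule ereal_le_epsilon2)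
  have sets: "sets (\<mu>s n) = sets (markov_shift_borel S)" "sets \<mu> = sets (markov_shift_borel S)"
    and inv: "invariant_prob_measure shift_map (\<mu>s n)" "invariant_prob_measure shift_map \<mu>" for n
    using assms(3)[of n] assms(4) by (simp_all add: ergodic_measures_def ergodic_prob_measure_def)
  have prob: "prob_space (\<mu>s n)" "prob_space \<mu>" for n
    using inv(1)[of n] inv(2) by (simp_all add: invariant_prob_measure_def)
  interpret \<mu>: prob_space \<mu> by (rule prob)
  have space: "space (\<mu>s n) = markov_shift_space S" "space \<mu> = markov_shift_space S" for n
    using sets_eq_imp_space_eq[OF sets(1)] sets_eq_imp_space_eq[OF sets(2)] by simp_all
  define V where "V a = {x \<in> markov_shift_space S. x 0 = a}" for a
  have V: "V a \<in> sets (markov_shift_borel S)" for a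
    by (rule sets_markov_shift_prefix[of _ _ 1]) (auto simp: V_def)
  \<comment> \<open>The countably many sets \<open>V a\<close> cover the space, so they cannot all
    be null.\<close>
  obtain a where a: "0 < measure \<mu> (V a)"
  proof (rule ccontr)
    assume "\<not> thesis"
    then have "measure \<mu> (V a) = 0" for a
      using that[of a] by (auto simp: zero_less_measure_iff)
    then have "V a \<in> null_sets \<mu>" for a
      using V sets by (simp add: null_sets_def \<mu>.emeasure_eq_measure)
    then have "(\<Union>a. V a) \<in> null_sets \<mu>" by (rule null_sets_UN)
    moreover have "(\<Union>a. V a) = space \<mu>" by (auto simp: V_def space)
    ultimately show False using \<mu>.emeasure_space_1 by (simp add: null_sets_def)
  qed
  obtain h where h: "topological_entropy S \<le> ereal h" "0 \<le> h"
  proof (cases "topological_entropy S")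
    case (real r)
    then show ?thesis using that[of "max r 0"] by simp
  qed (use assms(2) that[of 0] in auto)
  fix e :: real assume e: "0 < e"
  have "(\<lambda>n. 2 * h * measure \<mu> (avoiding S a n)) \<longlonglongrightarrow> 2 * h * 0"
    using a by (intro tendsto_mult tendsto_const avoiding_tendsto_zero[OF assms(4)]) (simp add: V_def)
  then have "\<forall>\<^sub>F n in sequentially. 2 * h * measure \<mu> (avoiding S a n) < e / 3"
    using e by (intro order_tendstoD(2)) auto
  then obtain T where T: "2 * h * measure \<mu> (avoiding S a T) < e / 3"
    by (auto simp: eventually_sequentially)
  \<comment> \<open>\<open>T\<close> is fixed before \<open>F\<close>, and both are chosen from
    \<mu> alone, not from \<open>n\<close>. Adding \<open>a\<close> makes its visits visible in the
    code.\<close>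
  define F where "F = insert a (\<Union>l\<in>{..2 * T}. \<Union> (set ` loops S a l))"
  have "finite (loops S a l)" for l
    using card_loops_le(1)[OF h(1), of l a] by (cases l) (auto simp: loops_def)
  then have F: "finite F" "a \<in> F" "\<And>l. l \<le> 2 * T \<Longrightarrow> \<Union> (set ` loops S a l) \<subseteq> F"
    by (auto simp: F_def)
  have simple: "simple_function (\<mu>s n) (letter_code F)" "simple_function \<mu> (letter_code F)" for n
    using simple_function_letter_code[OF F(1), of S] sets space by (simp_all add: simple_function_def)
  let ?H = "\<lambda>\<nu> k. shannon_entropy \<nu> (itinerary shift_map (letter_code F) k)"
  have "\<forall>\<^sub>F k in sequentially. ?H \<mu> k / k < entropy_rate shift_map \<mu> (letter_code F) + e / 3"
    using e by (intro order_tendstoD(2)[OF entropy_rate(1)[OF inv(2) simple(2)]]) simp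
  \<comment> \<open>A fixed \<open>k\<close> replaces the entropy rate, which need not be continuous
    in the measure, by a quantity that is weak* continuous and bounds the rate from above for every
    \<open>\<mu>s n\<close>.\<close>
  then obtain k where k: "0 < k" "?H \<mu> k / k < entropy_rate shift_map \<mu> (letter_code F) + e / 3"
    using eventually_conj[OF _ eventually_gt_at_top[of 0]] by (metis (no_types, lifting) eventually_sequentially order_refl)
  have lim1: "(\<lambda>n. ?H (\<mu>s n) k / k) \<longlonglongrightarrow> ?H \<mu> k / k"
  proof (intro tendsto_divide tendsto_const shannon_entropy_tendsto[OF assms(5) sets prob(1), where n=k])
    show "itinerary shift_map (letter_code F) k y = itinerary shift_map (letter_code F) k x" if "\<forall>i<k. y i = x i" for x y
      using that by (auto simp: itinerary_letter_code_eq_iff)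
  qed (use k in simp)
  have lim2: "(\<lambda>n. 2 * h * measure (\<mu>s n) (avoiding S a T)) \<longlonglongrightarrow> 2 * h * measure \<mu> (avoiding S a T)"
    by (intro tendsto_mult tendsto_const weak_star_tendsto_prefix[OF assms(5) sets, of _ T]) (auto simp: avoiding_def)
  have lim3: "(\<lambda>n. measure (\<mu>s n) (V a)) \<longlonglongrightarrow> measure \<mu> (V a)"
    by (intro weak_star_tendsto_prefix[OF assms(5) sets, of _ 1]) (auto simp: V_def)
  have "\<forall>\<^sub>F n in sequentially. ks_entropy shift_map (\<mu>s n) \<le> ks_entropy shift_map \<mu> + ereal e"
    using order_tendstoD(2)[OF lim1 k(2)] order_tendstoD(2)[OF lim2 T] order_tendstoD(1)[OF lim3 a]
  proof eventually_elim
    case (elim n)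
    \<comment> \<open>The third eventual condition says that \<open>\<mu>s n\<close> charges
      \<open>a\<close>, as the entropy inequality requires; the first two cost \<open>e / 3\<close>
      each.\<close>
    have "ks_entropy shift_map (\<mu>s n)
        \<le> ereal (entropy_rate shift_map (\<mu>s n) (letter_code F) + 2 * h * measure (\<mu>s n) (avoiding S a T))"
      using elim(3) by (intro ks_entropy_le_letter_code[OF assms(3) _ h F]) (simp_all add: V_def)
    also have "\<dots> \<le> ereal (entropy_rate shift_map \<mu> (letter_code F)) + ereal e"
      using entropy_rate(2)[OF inv(1) simple(1) k(1), of n] elim(1,2) e by simp
    also have "\<dots> \<le> ks_entropy shift_map \<mu> + ereal e"
      by (intro add_right_mono entropy_rate_le_ks_entropy simple)
    finally show ?case .
  qed
  then show "limsup (\<lambda>n. ks_entropy shift_map (\<mu>s n)) \<le> ks_entropy shift_map \<mu> + ereal e"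
    by (rule Limsup_bounded)
qed

end
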